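(* Let $P=D_t+Q(D_x)$ on $\mathbb{T}\times\mathbb{T}^n$, where $Q(D_x)=[Q_{j,k}(D_x)]_{m\times m}$ with $Q_{j,k}(D_x)\in\Psi^\nu(\mathbb{T}^n)$, $\nu\in\mathbb{R}$, and let $\kappa_1(\xi),\dots,\kappa_m(\xi)$ be the eigenvalues of the matrix symbol $Q(\xi)=[Q_{j,k}(\xi)]_{m\times m}$, $\xi\in\mathbb{Z}^n$. Then $P$ is globally hypoelliptic if and only if there are positive constants $C_j$, $M_j$ and $R_j$ such that $$|\tau+\kappa_j(\xi)|\ge C_j(|\tau|+|\xi|)^{-M_j},\quad |\tau|+|\xi|\ge R_j,\ (\tau,\xi)\in\mathbb{Z}\times\mathbb{Z}^n,$$ for $j=1,\dots,m$.
   Context: $\mathbb{T}=\mathbb{R}/2\pi\mathbb{Z}$, $D_t=i^{-1}\partial_t$ (acting on each coordinate). $\Psi^\nu(\mathbb{T}^n)$ is the class of operators $a(D_x)w(x)=\sum_{\xi\in\mathbb{Z}^n}e^{ix\cdot\xi}a(\xi)\widehat w(\xi)$ whose symbol satisfies $|a(\xi)|\le C|\xi|^\nu$ for all $\xi\in\mathbb{Z}^n\setminus\{0\}$, for some $C>0$. These operators act on distributions on $\mathbb{T}^{n+1}$ by multiplication of Fourier coefficients, so that $Pu=f$ means $(\tau I_{m\times m}+Q(\xi))\widehat u(\tau,\xi)=\widehat f(\tau,\xi)$ for all $(\tau,\xi)\in\mathbb{Z}\times\mathbb{Z}^n$. The eigenvalues $\kappa_j(\xi)$ are listed with multiplicity;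 they are the diagonal entries of a Schur form $S^*(\xi)Q(\xi)S(\xi)=\mathrm{diag}(\kappa_1(\xi),\dots,\kappa_m(\xi))+\mathcal{N}(\xi)$ with $S(\xi)$ unitary and $\mathcal{N}(\xi)$ strictly upper triangular. $\mathcal{D}'_m(\mathbb{T}^{n+1})$ and $C^\infty_m(\mathbb{T}^{n+1})$ are the spaces of $m$-dimensional vectors with coordinates in $\mathcal{D}'(\mathbb{T}^{n+1})$ and $C^\infty(\mathbb{T}^{n+1})$. $P$ is globally hypoelliptic if $u\in\mathcal{D}'_m(\mathbb{T}^{n+1})$ and $Pu\in C^\infty_m(\mathbb{T}^{n+1})$ imply $u\in C^\infty_m(\mathbb{T}^{n+1})$. *)

theory Defs
  imports "HOL-Analysis.Analysis" "HOL-Computational_Algebra.Polynomial"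
begin

section \<open>Smooth functions and distributions on the torus\<close>

text \<open>
  Functions on the torus $V/2\pi\mathbb{Z}^N$ are functions on a Euclidean space $V$ that are
  $2\pi$-periodic in the direction of every basis vector. The theorem uses
  \<^typ>\<open>real \<times> (real ^ 'n)\<close> for $V$, whose standard basis consists of the $t$-direction and
  the $x_i$-directions.
\<close>

definition torus_periodic :: "('a::euclidean_space \<Rightarrow> complex) \<Rightarrow> bool" where
  "torus_periodic f \<longleftrightarrow> (\<forall>b\<in>Basis. \<forall>x. f (x + (2 * pi) *\<^sub>R b) = f x)"

definition partial_deriv :: "'a::euclidean_space \<Rightarrow> ('a \<Rightarrow> complex) \<Rightarrow> ('a \<Rightarrow> complex)" where
  "partial_deriv b f = (\<lambda>x. frechet_derivative f (at x) b)"

definition iter_partial :: "'a::euclidean_space list \<Rightarrow> ('a \<Rightarrow> complex) \<Rightarrow> ('a \<Rightarrow> complex)" where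
  "iter_partial bs f = foldr partial_deriv bs f"

text \<open>
  \<^const>\<open>frechet_derivative\<close> is unspecified where the function is not differentiable, but the
  condition for a list \<open>bs\<close> is only informative together with the conditions for its tails, which
  say that all earlier derivatives are genuine.
\<close>

definition Cinf_torus :: "('a::euclidean_space \<Rightarrow> complex) set" where
  "Cinf_torus = {f. torus_periodic f \<and>
     (\<forall>bs \<in> lists Basis. iter_partial bs f differentiable_on UNIV)}"

text \<open>Convergence to zero in the Frechet space $C^\infty$ of the torus.\<close>

definition Cinf_null_seq :: "(nat \<Rightarrow> 'a::euclidean_space \<Rightarrow> complex) \<Rightarrow> bool" where
  "Cinf_null_seq \<phi> \<longleftrightarrow> (\<forall>k. \<phi> k \<in> Cinf_torus) \<and>
     (\<forall>bs \<in> lists Basis.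
        uniform_limit UNIV (\<lambda>k. iter_partial bs (\<phi> k)) (\<lambda>_. 0) sequentially)"

text \<open>
  Distributions are the continuous linear functionals on $C^\infty$ of the torus. They are
  represented by total functions, and their values outside \<^const>\<open>Cinf_torus\<close> are never used.
  Because $C^\infty$ is metrizable, continuity of a linear functional is sequential continuity
  at zero.
\<close>

definition distributions :: "(('a::euclidean_space \<Rightarrow> complex) \<Rightarrow> complex) set" where
  "distributions = {u.
     (\<forall>\<phi>\<in>Cinf_torus. \<forall>\<psi>\<in>Cinf_torus. u (\<lambda>x. \<phi> x + \<psi> x) = u \<phi> + u \<psi>) \<and>
     (\<forall>c. \<forall>\<phi>\<in>Cinf_torus. u (\<lambda>x. c * \<phi> x) = c * u \<phi>) \<and>
     (\<forall>\<phi>. Cinf_null_seq \<phi> \<longrightarrow> (\<lambda>k. u (\<phi> k)) \<longlonglongrightarrow> 0)}"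

text \<open>The distributions given by integration against a smooth function over a period cube.\<close>

definition smooth_distributions :: "(('a::euclidean_space \<Rightarrow> complex) \<Rightarrow> complex) set" where
  "smooth_distributions = {u \<in> distributions. \<exists>f\<in>Cinf_torus. \<forall>\<phi>\<in>Cinf_torus.
     u \<phi> = integral (cbox 0 ((2 * pi) *\<^sub>R One)) (\<lambda>x. f x * \<phi> x)}"

definition distributions_vec :: "((('a::euclidean_space \<Rightarrow> complex) \<Rightarrow> complex) ^ 'm) set" where
  "distributions_vec = {u. \<forall>j. u $ j \<in> distributions}"

definition smooth_distributions_vec ::
    "((('a::euclidean_space \<Rightarrow> complex) \<Rightarrow> complex) ^ 'm) set" where
  "smooth_distributions_vec = {u. \<forall>j. u $ j \<in> smooth_distributions}"

text \<open>
  $\widehat u(\eta) = (2\pi)^{-N} \langle u, e^{-i x\cdot\eta}\rangle$, normalised so that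
  $w(x) = \sum_\eta \widehat w(\eta) e^{i x\cdot\eta}$ for smooth $w$.
\<close>

definition fourier_coeff ::
    "(('a::euclidean_space \<Rightarrow> complex) \<Rightarrow> complex) \<Rightarrow> 'a \<Rightarrow> complex" where
  "fourier_coeff u \<eta> = u (\<lambda>x. cis (- (x \<bullet> \<eta>))) / of_real ((2 * pi) ^ DIM('a))"

definition fourier_coeff_vec ::
    "(('a::euclidean_space \<Rightarrow> complex) \<Rightarrow> complex) ^ 'm \<Rightarrow> 'a \<Rightarrow> complex ^ 'm" where
  "fourier_coeff_vec u \<eta> = (\<chi> j. fourier_coeff (u $ j) \<eta>)"


section \<open>Systems of Fourier multipliers\<close>

definition int_vec :: "int ^ 'n \<Rightarrow> real ^ 'n" where
  "int_vec \<xi> = (\<chi> i. real_of_int (\<xi> $ i))"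

text \<open>The symbols of the operators in $\Psi^\nu(\mathbb{T}^n)$.\<close>

definition symbol_class :: "real \<Rightarrow> (int ^ 'n \<Rightarrow> complex) set" where
  "symbol_class \<nu> = {a. \<exists>C>0. \<forall>\<xi>. \<xi> \<noteq> 0 \<longrightarrow> cmod (a \<xi>) \<le> C * norm (int_vec \<xi>) powr \<nu>}"

text \<open>
  $Pu = f$ for $P = D_t + Q(D_x)$. Note that \<^term>\<open>mat c\<close> is $c$ times the identity matrix.
\<close>

definition system_eq :: "(int ^ 'n \<Rightarrow> complex ^ 'm ^ 'm) \<Rightarrow>
    ((real \<times> (real ^ 'n) \<Rightarrow> complex) \<Rightarrow> complex) ^ 'm \<Rightarrow>
    ((real \<times> (real ^ 'n) \<Rightarrow> complex) \<Rightarrow> complex) ^ 'm \<Rightarrow> bool" where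
  "system_eq Q u f \<longleftrightarrow> (\<forall>(\<tau>::int) \<xi>.
     (mat (of_int \<tau>) + Q \<xi>) *v fourier_coeff_vec u (real_of_int \<tau>, int_vec \<xi>)
       = fourier_coeff_vec f (real_of_int \<tau>, int_vec \<xi>))"

definition globally_hypoelliptic :: "(int ^ 'n \<Rightarrow> complex ^ 'm ^ 'm) \<Rightarrow> bool" where
  "globally_hypoelliptic Q \<longleftrightarrow>
     (\<forall>u \<in> distributions_vec. \<forall>f \<in> smooth_distributions_vec.
        system_eq Q u f \<longrightarrow> u \<in> smooth_distributions_vec)"


section \<open>Eigenvalues listed with multiplicity\<close>

definition charpoly :: "complex ^ 'm ^ 'm \<Rightarrow> complex poly" where
  "charpoly A = det (mat [:0, 1:] - map_matrix (\<lambda>a. [:a:]) A)"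

text \<open>
  \<open>k\<close> lists the eigenvalues of \<open>A\<close>, each as often as its algebraic multiplicity.
\<close>

definition eigenvalue_listing :: "complex ^ 'm ^ 'm \<Rightarrow> ('m \<Rightarrow> complex) \<Rightarrow> bool" where
  "eigenvalue_listing A k \<longleftrightarrow> charpoly A = (\<Prod>j\<in>UNIV. [:- k j, 1:])"

text \<open>The diagonal of a Schur form of \<open>A\<close> is such a listing.\<close>

lemma eigenvalue_listing_Schur:
  fixes A S T :: "complex ^ 'm::{finite,wellorder} ^ 'm::{finite,wellorder}"
  assumes unitary: "map_matrix cnj (transpose S) ** S = mat 1"
    and Schur: "map_matrix cnj (transpose S) ** A ** S = T"
    and upper: "\<And>i j. j < i \<Longrightarrow> T $ i $ j = 0"
  shows "eigenvalue_listing A (\<lambda>j. T $ j $ j)"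
proof -
  define c :: "complex ^ 'm::{finite,wellorder} ^ 'm::{finite,wellorder} \<Rightarrow> complex poly ^ 'm::{finite,wellorder} ^ 'm::{finite,wellorder}" where "c = map_matrix (\<lambda>a. [:a:])"
  define X :: "complex poly ^ 'm::{finite,wellorder} ^ 'm::{finite,wellorder}" where "X = mat [:0, 1:]"
  define R where "R = map_matrix cnj (transpose S)"
  have const_sum: "(\<Sum>i\<in>I. [:f i:]) = [:sum f I:]" for f :: "'m::{finite,wellorder} \<Rightarrow> complex" and I
    by (induction I rule: infinite_finite_induct) (simp_all)
  have c_mult: "c (B ** C) = c B ** c C" for B C
    by (simp add: c_def vec_eq_iff matrix_matrix_mult_def const_sum [symmetric] mult.commute)
  have c_one: "c (mat 1) = mat 1"
    by (simp add: c_def vec_eq_iff mat_def one_pCons)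
  have X_comm: "B ** X = X ** B" for B
    by (simp add: X_def vec_eq_iff matrix_matrix_mult_def mat_def if_distrib if_distribR
        mult.commute cong: if_cong)
  have diff_l: "B ** (C - D) = B ** C - B ** D" and diff_r: "(C - D) ** B = C ** B - D ** B"
    for B C D :: "complex poly ^ 'm::{finite,wellorder} ^ 'm::{finite,wellorder}"
    by (simp_all add: vec_eq_iff matrix_matrix_mult_def algebra_simps sum_subtractf)
  have RS: "c R ** c S = mat 1"
    using unitary by (simp add: R_def c_one flip: c_mult)
  have "c R ** (X - c A) ** c S = X ** (c R ** c S) - c (R ** A ** S)"
    by (simp add: diff_l diff_r X_comm c_mult matrix_mul_assoc)
  also have "\<dots> = X - c T"
    unfolding RS using Schur by (simp add: R_def)
  finally have eq: "c R ** (X - c A) ** c S = X - c T" .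
  have "det (c R) * det (c S) = 1"
    using RS by (metis det_I det_mul)
  then have "det (X - c A) = det (X - c T)"
    unfolding eq [symmetric] det_mul by (simp add: mult.commute mult.left_commute)
  also have "\<dots> = (\<Prod>j\<in>UNIV. (X - c T) $ j $ j)"
    by (rule det_upperdiagonal) (simp add: X_def c_def mat_def upper)
  also have "\<dots> = (\<Prod>j\<in>UNIV. [:- (T $ j $ j), 1:])"
    by (simp add: X_def c_def mat_def)
  finally show ?thesis
    by (simp add: eigenvalue_listing_def charpoly_def X_def c_def)
qed

end

theory Submission
  imports Defs
begin

text \<open>
  A distribution on the torus is smooth if and only if its Fourier coefficients decrease
  rapidly, and any bounded family is the family of coefficients of a distribution. So
  hypoellipticity only concerns the linear systems
  $(\tau I + Q(\xi)) \widehat u(\tau,\xi) = \widehat f(\tau,\xi)$, where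
  $\det(\tau I + Q(\xi)) = \prod_j (\tau + \kappa_j(\xi))$. If the factors are bounded below
  by a negative power of $|\tau| + |\xi|$, Cramer's rule bounds $\widehat u$ by a polynomial
  times $\widehat f$. Otherwise $|\tau_k + \kappa_j(\xi_k)| < (|\tau_k| + |\xi_k|)^{-k}$ along a
  sequence going to infinity, and unit eigenvectors placed at these frequencies are the
  coefficients of a distribution that is not smooth although its image is.

  Fourier inversion follows from the uniqueness theorem, for which a function with vanishing
  coefficients is tested against powers of $\prod_b (1 + \cos (x_b - y_b))/2$, which
  concentrate at $y$.
\<close>

section \<open>The dual lattice\<close>

text \<open>Rapid decrease absorbs polynomial factors and ignores finitely many frequencies. Hence
  the exponents \<open>M j\<close> can be merged into one, the thresholds \<open>R j\<close> cost
  nothing, and Cramer's rule, which sees the eigenvalues only through their product, loses nothing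
  that matters. The analytic obstacle is that distributions are abstract functionals on smooth
  functions. Recovering one from its coefficients demands that a smooth function be the limit of its
  Fourier series in every derivative. Building one from coefficients demands a decay estimate for
  Fourier integrals that is uniform in the function: order \<open>K\<close> must be controlled by
  finitely many derivatives. Decay and orthogonality of characters both come from one fact: the
  derivative of a periodic function has integral zero over the period cube. That cube is closed, so
  for \<open>y\<close> on its boundary the concentrating kernel also peaks at translates of
  \<open>y\<close>. Uniqueness is therefore proved at interior points and then extended by
  continuity and periodicity.\<close>

definition torus_lattice :: "'a::euclidean_space set" where
  "torus_lattice = {\<eta>. \<forall>b\<in>Basis. \<eta> \<bullet> b \<in> \<int>}"

lemma torus_lattice_zero [simp]: "0 \<in> torus_lattice"
  by (simp add: torus_lattice_def)

lemma torus_lattice_Basis [simp]: "b \<in> Basis \<Longrightarrow> b \<in> torus_lattice"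
  by (auto simp: torus_lattice_def inner_Basis)

lemma torus_lattice_add [intro]: "x \<in> torus_lattice \<Longrightarrow> y \<in> torus_lattice \<Longrightarrow> x + y \<in> torus_lattice"
  by (simp add: torus_lattice_def inner_add_left)

lemma torus_lattice_diff [intro]: "x \<in> torus_lattice \<Longrightarrow> y \<in> torus_lattice \<Longrightarrow> x - y \<in> torus_lattice"
  by (simp add: torus_lattice_def inner_diff_left)

lemma torus_lattice_minus_iff [simp]: "- x \<in> torus_lattice \<longleftrightarrow> x \<in> torus_lattice"
  by (simp add: torus_lattice_def)

lemma Ints_inner_torus_lattice: "\<eta> \<in> torus_lattice \<Longrightarrow> b \<in> Basis \<Longrightarrow> \<eta> \<bullet> b \<in> \<int>"
  by (simp add: torus_lattice_def)

text \<open>Coordinates turn lattice points into elements of a \<open>PiE\<close> product of sets of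
  reals, where counting and sums of products are available; \<open>restrict\<close> makes the
  coordinate functions extensional.\<close>

lemma inj_on_restrict_inner: "inj_on (\<lambda>\<eta>. restrict (\<lambda>b. \<eta> \<bullet> b) Basis) (A :: 'a::euclidean_space
    set)"
  by (rule inj_onI, rule euclidean_eqI) (metis restrict_apply')

lemma countable_torus_lattice: "countable (torus_lattice :: 'a::euclidean_space set)"
proof (rule countable_image_inj_on[OF countable_subset inj_on_restrict_inner])
  show "(\<lambda>\<eta>::'a. restrict (\<lambda>b. \<eta> \<bullet> b) Basis) ` torus_lattice \<subseteq> (\<Pi>\<^sub>E b\<in>Basis. \<int>)"
    by (auto simp: torus_lattice_def)
  have "countable (\<int> :: real set)"
    by (simp add: Ints_def)
  then show "countable (\<Pi>\<^sub>E b\<in>(Basis::'a set). (\<int> :: real set))"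
    by (intro countable_PiE) auto
qed

lemma infinite_torus_lattice: "infinite (torus_lattice :: 'a::euclidean_space set)"
proof -
  obtain b :: 'a where b: "b \<in> Basis"
    using nonempty_Basis by blast
  have "inj (\<lambda>n::nat. real n *\<^sub>R b)"
    using b by (auto intro!: injI)
  moreover have "range (\<lambda>n::nat. real n *\<^sub>R b) \<subseteq> torus_lattice"
    using b by (auto simp: torus_lattice_def inner_Basis)
  ultimately show ?thesis
    using finite_subset range_inj_infinite by blast
qed

lemma finite_torus_lattice_bounded: "finite {\<eta> \<in> (torus_lattice :: 'a::euclidean_space set). norm
    \<eta> \<le> r}"
proof (rule inj_on_finite[OF inj_on_restrict_inner])
  show "(\<lambda>\<eta>::'a. restrict (\<lambda>b. \<eta> \<bullet> b) Basis) ` {\<eta> \<in> torus_lattice. norm \<eta> \<le> r}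
     \<subseteq> (\<Pi>\<^sub>E b\<in>Basis. {x\<in>\<int>. \<bar>x\<bar> \<le> r})"
    using Basis_le_norm order_trans by (fastforce simp: torus_lattice_def)
  show "finite (\<Pi>\<^sub>E b\<in>(Basis::'a set). {x\<in>\<int>. \<bar>x\<bar> \<le> r})"
    by (intro finite_PiE finite_abs_int_segment) auto
qed

text \<open>A finite set of integers lies in an initial segment of the naturals together with its
  negative, so twice the convergent series is a bound. Bounds over finite subsets let the argument
  pass to several coordinates by pure algebra.\<close>

lemma sum_Ints_inverse_square_bounded:
  obtains A :: real where "\<And>T. finite T \<Longrightarrow> T \<subseteq> \<int> \<Longrightarrow> (\<Sum>t\<in>T. 1 / (1 + \<bar>t\<bar>)\<^sup>2) \<le> A"
proof
  fix T :: "real set" assume T: "finite T" "T \<subseteq> \<int>"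
  define f :: "real \<Rightarrow> real" where "f = (\<lambda>t. 1 / (1 + \<bar>t\<bar>)\<^sup>2)"
  have sm: "summable (\<lambda>n. 1 / (1 + real n)\<^sup>2)"
    using inverse_squares_sums[THEN sums_summable] by (simp add: add.commute)
  obtain K :: nat where K: "\<And>t. t \<in> T \<Longrightarrow> \<bar>t\<bar> \<le> real K"
  proof (cases "T = {}")
    case False
    then have "\<bar>t\<bar> \<le> real (nat \<lceil>Max (abs ` T)\<rceil>)" if "t \<in> T" for t
      using that T by (meson Max_ge finite_imageI imageI order_trans real_nat_ceiling_ge)
    then show thesis using that by blast
  qed (use that in auto)
  have "T \<subseteq> real ` {..K} \<union> (\<lambda>n. - real n) ` {..K}"
  proof
    fix t assume t: "t \<in> T"
    then obtain k where k: "t = of_int k" using T(2) by (auto elim!: Ints_cases)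
    have "nat \<bar>k\<bar> \<le> K" using K[OF t] k by linarith
    moreover have "t = real (nat \<bar>k\<bar>) \<or> t = - real (nat \<bar>k\<bar>)" using k by linarith
    ultimately show "t \<in> real ` {..K} \<union> (\<lambda>n. - real n) ` {..K}" by blast
  qed
  then have "sum f T \<le> sum f (real ` {..K} \<union> (\<lambda>n. - real n) ` {..K})"
    by (intro sum_mono2) (auto simp: f_def)
  also have "\<dots> \<le> sum f (real ` {..K}) + sum f ((\<lambda>n. - real n) ` {..K})"
    by (subst sum_Un) (auto intro!: sum_nonneg simp: f_def)
  also have "\<dots> = 2 * (\<Sum>n\<le>K. 1 / (1 + real n)\<^sup>2)"
    by (subst (1 2) sum.reindex) (auto simp: f_def inj_on_def)
  also have "\<dots> \<le> 2 * (\<Sum>n. 1 / (1 + real n)\<^sup>2)"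
    using sm by (intro mult_left_mono sum_le_suminf) auto
  finally show "(\<Sum>t\<in>T. 1 / (1 + \<bar>t\<bar>)\<^sup>2) \<le> 2 * (\<Sum>n. 1 / (1 + real n)\<^sup>2)"
    by (simp add: f_def)
qed

text \<open>The weight is dominated by the product of the weights of the coordinates, so that the sum
  factorises.\<close>

lemma sum_torus_lattice_bounded:
  obtains A :: real where
    "\<And>F. finite F \<Longrightarrow> F \<subseteq> (torus_lattice :: 'a::euclidean_space set) \<Longrightarrow>
       (\<Sum>\<eta>\<in>F. 1 / (1 + norm \<eta>) ^ (2 * DIM('a))) \<le> A"
proof -
  obtain A :: real where A: "\<And>T. finite T \<Longrightarrow> T \<subseteq> \<int> \<Longrightarrow> (\<Sum>t\<in>T. 1 / (1 + \<bar>t\<bar>)\<^sup>2) \<le> A"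
    using sum_Ints_inverse_square_bounded by blast
  show thesis
  proof
    fix F :: "'a set" assume F: "finite F" "F \<subseteq> torus_lattice"
    define g :: "'a \<Rightarrow> 'a \<Rightarrow> real" where "g = (\<lambda>\<eta>. restrict (\<lambda>b. \<eta> \<bullet> b) Basis)"
    define T where "T = (\<lambda>b. (\<lambda>\<eta>. \<eta> \<bullet> b) ` F)"
    \<comment> \<open>Each coordinate consumes two powers of \<open>1 + norm \<eta>\<close>, which
      explains the exponent \<open>2 * DIM('a)\<close>.\<close>
    have le: "1 / (1 + norm \<eta>) ^ (2 * DIM('a)) \<le> (\<Prod>b\<in>Basis. 1 / (1 + \<bar>g \<eta> b\<bar>)\<^sup>2)" for \<eta> :: 'a
    proof -
      have "(\<Prod>b\<in>(Basis::'a set). 1 / (1 + norm \<eta>)\<^sup>2) \<le> (\<Prod>b\<in>Basis. 1 / (1 + \<bar>g \<eta> b\<bar>)\<^sup>2)"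
        by (intro prod_mono conjI divide_left_mono power_mono add_left_mono mult_pos_pos
            zero_less_power)
           (auto simp: g_def Basis_le_norm intro!: add_pos_nonneg)
      then show ?thesis by (simp add: power_mult power_one_over)
    qed
    have "(\<Sum>\<eta>\<in>F. 1 / (1 + norm \<eta>) ^ (2 * DIM('a))) \<le> (\<Sum>\<eta>\<in>F. \<Prod>b\<in>Basis. 1 / (1 + \<bar>g \<eta> b\<bar>)\<^sup>2)"
      by (intro sum_mono le)
    also have "\<dots> = (\<Sum>h\<in>g ` F. \<Prod>b\<in>Basis. 1 / (1 + \<bar>h b\<bar>)\<^sup>2)"
      unfolding g_def by (subst sum.reindex[OF inj_on_restrict_inner]) simp
    \<comment> \<open>Enlarging \<open>F\<close> to the full product of its coordinate projections
      only adds nonnegative terms and lets the sum factorise.\<close>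
    also have "\<dots> \<le> (\<Sum>h\<in>(\<Pi>\<^sub>E b\<in>Basis. T b). \<Prod>b\<in>Basis. 1 / (1 + \<bar>h b\<bar>)\<^sup>2)"
      using F by (intro sum_mono2) (auto intro!: finite_PiE prod_nonneg simp: T_def g_def)
    also have "\<dots> = (\<Prod>b\<in>Basis. \<Sum>t\<in>T b. 1 / (1 + \<bar>t\<bar>)\<^sup>2)"
      using F by (subst prod_sum_PiE) (auto simp: T_def)
    also have "\<dots> \<le> (\<Prod>b\<in>(Basis::'a set). A)"
      using F by (intro prod_mono conjI A sum_nonneg) (auto simp: T_def torus_lattice_def)
    finally show "(\<Sum>\<eta>\<in>F. 1 / (1 + norm \<eta>) ^ (2 * DIM('a))) \<le> (\<Prod>b\<in>(Basis::'a set). A)" .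
  qed
qed

text \<open>A bijective numbering turns sums over the lattice into ordinary series, to which
  termwise differentiation and tail estimates apply.\<close>

definition freq :: "nat \<Rightarrow> 'a::euclidean_space" where
  "freq = from_nat_into torus_lattice"

lemma bij_betw_freq: "bij_betw freq UNIV torus_lattice"
  unfolding freq_def
  by (rule bij_betw_from_nat_into[OF countable_torus_lattice infinite_torus_lattice])

lemma freq_in_lattice [simp]: "freq k \<in> torus_lattice"
  using bij_betw_freq by (auto simp: bij_betw_def)

lemma freq_eq_iff [simp]: "freq j = freq k \<longleftrightarrow> j = k"
  using bij_betw_freq by (auto simp: bij_betw_def inj_def)

lemma torus_lattice_freqE:
  assumes "\<eta> \<in> torus_lattice" obtains k where "\<eta> = freq k"
  using assms bij_betw_freq by (metis bij_betw_imp_surj_on imageE)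

lemma summable_freq_weight:
  "summable (\<lambda>k. 1 / (1 + norm (freq k :: 'a::euclidean_space)) ^ (2 * DIM('a)))"
proof -
  obtain A :: real where A: "\<And>F. finite F \<Longrightarrow> F \<subseteq> (torus_lattice :: 'a set) \<Longrightarrow>
       (\<Sum>\<eta>\<in>F. 1 / (1 + norm \<eta>) ^ (2 * DIM('a))) \<le> A"
    using sum_torus_lattice_bounded by blast
  have "(\<Sum>k<n. 1 / (1 + norm (freq k :: 'a)) ^ (2 * DIM('a))) \<le> A" for n
  proof -
    have "(\<Sum>k<n. 1 / (1 + norm (freq k :: 'a)) ^ (2 * DIM('a)))
        = (\<Sum>\<eta>\<in>freq ` {..<n}. 1 / (1 + norm (\<eta> :: 'a)) ^ (2 * DIM('a)))"
      by (subst sum.reindex) (auto simp: inj_on_def)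
    also have "\<dots> \<le> A"
      by (rule A) auto
    finally show ?thesis .
  qed
  then show ?thesis
    by (intro summableI_nonneg_bounded[where x = A]) (auto intro!: divide_nonneg_nonneg)
qed

text \<open>Only the values on the lattice are constrained. The weight
  \<open>1 + norm \<eta>\<close> is at least 1, so frequency zero requires no separate
  treatment.\<close>

definition rapidly_decreasing :: "('a::euclidean_space \<Rightarrow> complex) \<Rightarrow> bool" where
  "rapidly_decreasing c \<longleftrightarrow> (\<forall>K. \<exists>C. \<forall>\<eta>\<in>torus_lattice. cmod (c \<eta>) * (1 + norm \<eta>) ^ K \<le> C)"

text \<open>Finitely many frequencies merely enlarge the constant, and the exceptional set may
  depend on \<open>K\<close>. Both the threshold on frequencies and the counterexample sequence use
  this freedom.\<close>

lemma rapidly_decreasing_cofiniteI: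
  fixes c :: "'a::euclidean_space \<Rightarrow> complex"
  assumes "\<And>K. \<exists>C F. finite F \<and> (\<forall>\<eta>\<in>torus_lattice - F. cmod (c \<eta>) * (1 + norm \<eta>) ^ K \<le> C)"
  shows "rapidly_decreasing c"
  unfolding rapidly_decreasing_def
proof
  fix K
  obtain C F where F: "finite F"
    and C: "\<And>\<eta>. \<eta> \<in> torus_lattice - F \<Longrightarrow> cmod (c \<eta>) * (1 + norm \<eta>) ^ K \<le> C"
    using assms by meson
  \<comment> \<open>The absolute value is needed at frequencies in \<open>F\<close>, since
    \<open>C\<close> may be negative.\<close>
  define C' where "C' = \<bar>C\<bar> + (\<Sum>\<eta>\<in>F. cmod (c \<eta>) * (1 + norm \<eta>) ^ K)"
  have "cmod (c \<eta>) * (1 + norm \<eta>) ^ K \<le> C'" if "\<eta> \<in> torus_lattice" for \<eta>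
  proof (cases "\<eta> \<in> F")
    case True
    have "cmod (c \<eta>) * (1 + norm \<eta>) ^ K \<le> (\<Sum>\<eta>\<in>F. cmod (c \<eta>) * (1 + norm \<eta>) ^ K)"
      by (rule member_le_sum[OF True]) (auto simp: F)
    then show ?thesis unfolding C'_def by linarith
  next
    case False
    have "0 \<le> (\<Sum>\<eta>\<in>F. cmod (c \<eta>) * (1 + norm \<eta>) ^ K)"
      by (intro sum_nonneg) auto
    moreover have "cmod (c \<eta>) * (1 + norm \<eta>) ^ K \<le> C"
      using C that False by blast
    ultimately show ?thesis unfolding C'_def by linarith
  qed
  then show "\<exists>C. \<forall>\<eta>\<in>torus_lattice. cmod (c \<eta>) * (1 + norm \<eta>) ^ K \<le> C" by blast
qed

text \<open>Decay of \<open>d\<close> at order \<open>K\<close> is bought with decay of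
  \<open>c\<close> at order \<open>p + K\<close>.\<close>

lemma rapidly_decreasing_dominated:
  assumes c: "rapidly_decreasing c"
    and d: "\<And>\<eta>. \<eta> \<in> torus_lattice \<Longrightarrow> cmod (d \<eta>) \<le> B * (1 + norm \<eta>) ^ p * cmod (c \<eta>)"
  shows "rapidly_decreasing d"
  unfolding rapidly_decreasing_def
proof
  fix K
  obtain C where C: "\<And>\<eta>. \<eta> \<in> torus_lattice \<Longrightarrow> cmod (c \<eta>) * (1 + norm \<eta>) ^ (p + K) \<le> C"
    using c unfolding rapidly_decreasing_def by meson
  have "cmod (d \<eta>) * (1 + norm \<eta>) ^ K \<le> \<bar>B\<bar> * C" if "\<eta> \<in> torus_lattice" for \<eta>
  proof -
    have "cmod (d \<eta>) \<le> \<bar>B\<bar> * (1 + norm \<eta>) ^ p * cmod (c \<eta>)"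
      using d[OF that] by (smt (verit) mult_right_mono norm_ge_zero zero_le_power)
    then have "cmod (d \<eta>) * (1 + norm \<eta>) ^ K \<le> \<bar>B\<bar> * (cmod (c \<eta>) * (1 + norm \<eta>) ^ (p + K))"
      by (smt (verit, ccfv_SIG) mult_right_mono norm_ge_zero power_add zero_le_power mult.assoc
          mult.commute mult.left_commute)
    also have "\<dots> \<le> \<bar>B\<bar> * C"
      by (intro mult_left_mono C that) auto
    finally show ?thesis .
  qed
  then show "\<exists>C. \<forall>\<eta>\<in>torus_lattice. cmod (d \<eta>) * (1 + norm \<eta>) ^ K \<le> C" by blast
qed

lemma rapidly_decreasing_finite_support:
  fixes c :: "'a::euclidean_space \<Rightarrow> complex"
  assumes "finite F" "\<And>\<eta>. \<eta> \<notin> F \<Longrightarrow> c \<eta> = 0"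
  shows "rapidly_decreasing c"
  proof (rule rapidly_decreasing_cofiniteI)
  show "\<exists>C F. finite F \<and> (\<forall>\<eta>\<in>torus_lattice - F. cmod (c \<eta>) * (1 + norm \<eta>) ^ K \<le> C)" for K
    using assms by (intro exI[of _ 0] exI[of _ F]) auto
qed

text \<open>Decay at order \<open>K + 2 * DIM('a)\<close> leaves the summable lattice weight as
  majorant.\<close>

lemma summable_rapidly_decreasing_power:
  fixes c :: "'a::euclidean_space \<Rightarrow> complex"
  assumes "rapidly_decreasing c"
  shows "summable (\<lambda>k. cmod (c (freq k)) * (1 + norm (freq k :: 'a)) ^ K)"
proof -
  obtain C where C: "\<And>\<eta>. \<eta> \<in> torus_lattice \<Longrightarrow> cmod (c \<eta>) * (1 + norm \<eta>) ^ (K + 2 * DIM('a)) \<le> C"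
    using assms unfolding rapidly_decreasing_def by meson
  show ?thesis
  proof (rule summable_comparison_test')
    show "summable (\<lambda>k. C * (1 / (1 + norm (freq k :: 'a)) ^ (2 * DIM('a))))"
      by (intro summable_mult summable_freq_weight)
    fix k
    have "0 < (1 + norm (freq k :: 'a)) ^ (2 * DIM('a))"
      by (intro zero_less_power add_pos_nonneg) auto
    then show "norm (cmod (c (freq k)) * (1 + norm (freq k :: 'a)) ^ K) \<le> C * (1 / (1
        + norm (freq k :: 'a)) ^ (2 * DIM('a)))"
      using C[OF freq_in_lattice, of k] by (simp add: field_simps power_add)
  qed
qed

lemma summable_rapidly_decreasing:
  "rapidly_decreasing c \<Longrightarrow> summable (\<lambda>k. cmod (c (freq k)))"
  using summable_rapidly_decreasing_power[of c 0] by simp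


section \<open>Fourier series with rapidly decreasing coefficients\<close>

definition fourier_series :: "('a::euclidean_space \<Rightarrow> complex) \<Rightarrow> 'a \<Rightarrow> complex" where
  "fourier_series c x = (\<Sum>k. c (freq k) * cis (x \<bullet> freq k))"

text \<open>The bound involves only the majorant \<open>g\<close>, so it is uniform in any parameter
  on which \<open>f\<close> depends, as in the Weierstrass test.\<close>

lemma norm_partial_sum_diff_suminf_le:
  fixes f :: "nat \<Rightarrow> 'b::banach"
  assumes "\<And>k. norm (f k) \<le> g k" "summable g"
  shows "norm (sum f {..<n} - suminf f) \<le> suminf g - sum g {..<n}"
proof -
  have f: "summable f"
    using assms summable_comparison_test' by blast
  have "suminf f - sum f {..<n} = (\<Sum>k. f (k + n))"
    by (rule suminf_minus_initial_segment[OF f, symmetric])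
  also have "norm \<dots> \<le> (\<Sum>k. g (k + n))"
    using assms by (intro norm_suminf_le summable_ignore_initial_segment) auto
  also have "\<dots> = suminf g - sum g {..<n}"
    by (rule suminf_minus_initial_segment[OF assms(2)])
  finally show ?thesis by (simp add: norm_minus_commute)
qed

lemma suminf_minus_partial_sum_tendsto_0:
  fixes g :: "nat \<Rightarrow> real"
  assumes "summable g"
  shows "(\<lambda>n. suminf g - sum g {..<n}) \<longlonglongrightarrow> 0"
  using tendsto_diff[OF tendsto_const summable_LIMSEQ[OF assms], of "suminf g"] by simp

lemma summable_fourier_series:
  assumes "rapidly_decreasing c"
  shows "summable (\<lambda>k. c (freq k) * cis (x \<bullet> freq k))"
  by (rule summable_comparison_test'[OF summable_rapidly_decreasing[OF assms]]) (simp add: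
      norm_mult)

lemma norm_fourier_series_le:
  assumes "rapidly_decreasing c"
  shows "cmod (fourier_series c x) \<le> (\<Sum>k. cmod (c (freq k)))"
  unfolding fourier_series_def
  by (rule norm_suminf_le) (auto simp: norm_mult summable_rapidly_decreasing[OF assms])

text \<open>The Fourier multiplier of the iterated partial derivative along
  \<open>bs\<close>.\<close>

definition deriv_symbol :: "'a::euclidean_space list \<Rightarrow> 'a \<Rightarrow> complex" where
  "deriv_symbol bs \<eta> = (\<Prod>b\<leftarrow>bs. \<i> * of_real (\<eta> \<bullet> b))"

lemma cmod_deriv_symbol_le:
  assumes "bs \<in> lists Basis"
  shows "cmod (deriv_symbol bs \<eta>) \<le> (1 + norm \<eta>) ^ length bs"
  using assms
proof (induction bs)
  case Nil
  then show ?case by (simp add: deriv_symbol_def)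
next
  case (Cons b bs)
  then have "\<bar>\<eta> \<bullet> b\<bar> \<le> 1 + norm \<eta>"
    using Basis_le_norm[of b \<eta>] by auto
  with Cons show ?case
    by (auto simp: deriv_symbol_def norm_mult intro!: mult_mono)
qed

lemma rapidly_decreasing_deriv_symbol:
  assumes "rapidly_decreasing c" "bs \<in> lists Basis"
  shows "rapidly_decreasing (\<lambda>\<eta>. deriv_symbol bs \<eta> * c \<eta>)"
  by (rule rapidly_decreasing_dominated[OF assms(1), where B = 1 and p = "length bs"])
     (auto simp: norm_mult intro!: mult_right_mono cmod_deriv_symbol_le assms)

text \<open>Termwise differentiation is justified because the differentiated series converges
  uniformly in \<open>x\<close> as a series of linear maps in \<open>h\<close>.\<close>

lemma fourier_series_has_derivative:
  fixes c :: "'a::euclidean_space \<Rightarrow> complex"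
  assumes c: "rapidly_decreasing c"
  shows "(fourier_series c has_derivative
           (\<lambda>h. \<Sum>k. \<i> * of_real (h \<bullet> freq k) * (c (freq k) * cis (x \<bullet> freq k)))) (at x)"
proof -
  define f where "f = (\<lambda>k (x::'a). c (freq k) * cis (x \<bullet> freq k))"
  define f' where "f' = (\<lambda>k (x::'a) (h::'a). \<i> * of_real (h \<bullet> freq k) * (c (freq k)
      * cis (x \<bullet> freq k)))"
  \<comment> \<open>The extra power pays for the factor \<open>h \<bullet> freq k\<close> produced
    by differentiating a character.\<close>
  define g where "g = (\<lambda>k. cmod (c (freq k)) * (1 + norm (freq k :: 'a)) ^ 1)"
  have g: "summable g"
    unfolding g_def by (rule summable_rapidly_decreasing_power[OF c])
  have "\<exists>G. \<forall>x\<in>UNIV. (\<lambda>k. f k x) sums G x \<and> (G has_derivative (\<lambda>h. \<Sum>k. f' k x h)) (at x within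
      UNIV)"
  proof (rule has_derivative_series)
    fix k :: nat and x :: 'a
    show "(f k has_derivative f' k x) (at x within UNIV)"
      unfolding f_def f'_def by (auto intro!: derivative_eq_intros simp: scaleR_conv_of_real)
  next
    fix e :: real assume "e > 0"
    then have "\<forall>\<^sub>F n in sequentially. suminf g - sum g {..<n} < e"
      using suminf_minus_partial_sum_tendsto_0[OF g] by (simp add: order_tendsto_iff)
    then show "\<forall>\<^sub>F n in sequentially. \<forall>x\<in>UNIV. \<forall>h. norm ((\<Sum>k<n. f' k x h) - (\<Sum>k. f' k x h)) \<le> e
        * norm h"
    proof eventually_elim
      case (elim n)
      show ?case
      proof (intro ballI allI)
        fix x h :: 'a
        have le: "norm (f' k x h) \<le> g k * norm h" for k
        proof -
          have "\<bar>h \<bullet> freq k\<bar> \<le> (1 + norm (freq k :: 'a)) * norm h"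
            using Cauchy_Schwarz_ineq2[of h "freq k"] by (simp add: algebra_simps add_increasing)
          then show ?thesis
            unfolding f'_def g_def using mult_left_mono[of "\<bar>h \<bullet> freq k\<bar>" _ "cmod (c (freq k))"]
            by (fastforce simp: norm_mult mult_ac)
        qed
        have "norm ((\<Sum>k<n. f' k x h) - (\<Sum>k. f' k x h)) \<le> (\<Sum>k. g k * norm h) - (\<Sum>k<n. g k * norm h)"
          by (intro norm_partial_sum_diff_suminf_le le summable_mult2 g)
        also have "\<dots> = (suminf g - sum g {..<n}) * norm h"
          by (simp add: left_diff_distrib sum_distrib_right suminf_mult2[OF g])
        also have "\<dots> \<le> e * norm h"
          using elim by (intro mult_right_mono) auto
        finally show "norm ((\<Sum>k<n. f' k x h) - (\<Sum>k. f' k x h)) \<le> e * norm h" .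
      qed
    qed
  next
    show "(\<lambda>k. f k 0) sums (\<Sum>k. f k 0)"
      unfolding f_def using summable_fourier_series[OF c, of 0] by (simp add: summable_sums)
  qed auto
  then obtain G where G: "\<And>x. (\<lambda>k. f k x) sums G x"
    "\<And>x. (G has_derivative (\<lambda>h. \<Sum>k. f' k x h)) (at x)"
    by auto
  have "fourier_series c = G"
    using G(1) by (auto simp: fourier_series_def f_def sums_iff)
  then show ?thesis
    using G(2) by (simp add: f'_def)
qed

lemma partial_deriv_fourier_series:
  assumes "rapidly_decreasing c" "b \<in> Basis"
  shows "partial_deriv b (fourier_series c) = fourier_series (\<lambda>\<eta>. \<i> * of_real (\<eta> \<bullet> b) * c \<eta>)"
proof
  fix x
  show "partial_deriv b (fourier_series c) x = fourier_series (\<lambda>\<eta>. \<i> * of_real (\<eta> \<bullet> b) * c \<eta>) x"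
    unfolding partial_deriv_def frechet_derivative_at[OF fourier_series_has_derivative[OF
        assms(1)], symmetric]
    by (simp add: fourier_series_def inner_commute mult_ac)
qed

lemma iter_partial_fourier_series:
  assumes "rapidly_decreasing c" "bs \<in> lists Basis"
  shows "iter_partial bs (fourier_series c) = fourier_series (\<lambda>\<eta>. deriv_symbol bs \<eta> * c \<eta>)"
  using assms(2)
proof (induction bs)
  case Nil
  then show ?case by (simp add: iter_partial_def deriv_symbol_def)
next
  case (Cons b bs)
  then have "iter_partial (b # bs) (fourier_series c)
      = partial_deriv b (fourier_series (\<lambda>\<eta>. deriv_symbol bs \<eta> * c \<eta>))"
    by (simp add: iter_partial_def)
  also have "\<dots> = fourier_series (\<lambda>\<eta>. \<i> * of_real (\<eta> \<bullet> b) * (deriv_symbol bs \<eta> * c \<eta>))"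
    using Cons by (intro partial_deriv_fourier_series rapidly_decreasing_deriv_symbol assms) auto
  finally show ?case
    by (simp add: deriv_symbol_def mult.assoc)
qed

section \<open>Smoothness and periodicity of Fourier series and characters\<close>

lemma cis_inner_add_period:
  fixes b :: "'a::euclidean_space"
  assumes "\<eta> \<in> torus_lattice" "b \<in> Basis"
  shows "cis ((x + (2 * pi) *\<^sub>R b) \<bullet> \<eta>) = cis (x \<bullet> \<eta>)"
proof -
  have "b \<bullet> \<eta> \<in> \<int>"
    using assms by (metis Ints_inner_torus_lattice inner_commute)
  then have "cis (2 * pi * (b \<bullet> \<eta>)) = 1"
    by (rule cis_multiple_2pi)
  then show ?thesis
    by (simp add: inner_add_left flip: cis_mult)
qed

lemma fourier_series_Cinf:
  assumes "rapidly_decreasing c"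
  shows "fourier_series c \<in> Cinf_torus"
proof -
  have "torus_periodic (fourier_series c)"
    by (simp add: torus_periodic_def fourier_series_def cis_inner_add_period)
  moreover have "iter_partial bs (fourier_series c) differentiable_on UNIV" if "bs \<in> lists Basis"
      for bs
    unfolding iter_partial_fourier_series[OF assms that]
    using fourier_series_has_derivative[OF rapidly_decreasing_deriv_symbol[OF assms that]]
    by (auto simp: differentiable_on_def differentiable_def)
  ultimately show ?thesis by (simp add: Cinf_torus_def)
qed

lemma fourier_series_delta:
  assumes "\<eta> \<in> torus_lattice"
  shows "fourier_series (\<lambda>\<xi>. if \<xi> = \<eta> then a else 0) x = a * cis (x \<bullet> \<eta>)"
proof -
  obtain j where j: "\<eta> = freq j"
    using assms by (rule torus_lattice_freqE)
  have "fourier_series (\<lambda>\<xi>. if \<xi> = \<eta> then a else 0) x = (\<Sum>k\<in>{j}. (if freq k = \<eta> then a else 0)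
      * cis (x \<bullet> freq k))"
    unfolding fourier_series_def by (rule suminf_finite) (auto simp: j)
  then show ?thesis by (simp add: j)
qed

lemma rapidly_decreasing_delta: "rapidly_decreasing (\<lambda>\<xi>. if \<xi> = \<eta> then a else 0)"
  by (rule rapidly_decreasing_finite_support[where F = "{\<eta>}"]) auto

text \<open>A character is the Fourier series of a family supported at one frequency, so its
  smoothness is a special case.\<close>

lemma character_Cinf:
  assumes "\<eta> \<in> torus_lattice"
  shows "(\<lambda>x. a * cis (x \<bullet> \<eta>)) \<in> Cinf_torus"
proof -
  have "fourier_series (\<lambda>\<xi>. if \<xi> = \<eta> then a else 0) = (\<lambda>x. a * cis (x \<bullet> \<eta>))"
    by (rule ext) (rule fourier_series_delta[OF assms])
  then show ?thesis
    using fourier_series_Cinf[OF rapidly_decreasing_delta] by metis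
qed

text \<open>Cutting off the coefficients instead of the sum makes each remainder a Fourier series
  again, with all its derivatives known.\<close>

definition tail_coeffs :: "nat \<Rightarrow> ('a::euclidean_space \<Rightarrow> complex) \<Rightarrow> 'a \<Rightarrow> complex" where
  "tail_coeffs n c \<eta> = (if \<eta> \<in> freq ` {..<n} then 0 else c \<eta>)"

lemma tail_coeffs_freq [simp]: "tail_coeffs n c (freq k) = (if k < n then 0 else c (freq k))"
  by (auto simp: tail_coeffs_def)

lemma rapidly_decreasing_tail_coeffs:
  "rapidly_decreasing c \<Longrightarrow> rapidly_decreasing (tail_coeffs n c)"
  by (erule rapidly_decreasing_dominated[where B = 1 and p = 0]) (auto simp: tail_coeffs_def)

lemma fourier_series_tail_0: "fourier_series (tail_coeffs 0 c) = fourier_series c"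
  by (simp add: fourier_series_def fun_eq_iff)

lemma fourier_series_tail_Suc:
  assumes "rapidly_decreasing c"
  shows "fourier_series (tail_coeffs n c) x
    = c (freq n) * cis (x \<bullet> freq n) + fourier_series (tail_coeffs (Suc n) c) x"
proof -
  have "fourier_series (tail_coeffs n c) x - fourier_series (tail_coeffs (Suc n) c) x
    = (\<Sum>k. tail_coeffs n c (freq k) * cis (x \<bullet> freq k) - tail_coeffs (Suc n) c (freq k)
        * cis (x \<bullet> freq k))"
    unfolding fourier_series_def
    by (intro suminf_diff summable_fourier_series rapidly_decreasing_tail_coeffs assms)
  also have "\<dots> = (\<Sum>k\<in>{n}. tail_coeffs n c (freq k)
      * cis (x \<bullet> freq k) - tail_coeffs (Suc n) c (freq k) * cis (x \<bullet> freq k))"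
    by (rule suminf_finite) auto
  finally show ?thesis by (simp add: algebra_simps)
qed

text \<open>Each derivative of the remainder is bounded, uniformly in \<open>x\<close>, by the tail
  of a convergent numerical series. This is convergence of the Fourier series in the topology that
  distributions respect.\<close>

lemma fourier_series_tail_null_seq:
  fixes c :: "'a::euclidean_space \<Rightarrow> complex"
  assumes c: "rapidly_decreasing c"
  shows "Cinf_null_seq (\<lambda>n. fourier_series (tail_coeffs n c))"
  unfolding Cinf_null_seq_def
proof (intro conjI allI ballI)
  fix n show "fourier_series (tail_coeffs n c) \<in> Cinf_torus"
    by (intro fourier_series_Cinf rapidly_decreasing_tail_coeffs c)
next
  fix bs :: "'a list" assume bs: "bs \<in> lists Basis"
  define g where "g = (\<lambda>k. cmod (deriv_symbol bs (freq k) * c (freq k)))"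
  have g: "summable g"
    unfolding g_def by (intro summable_rapidly_decreasing[OF rapidly_decreasing_deriv_symbol[OF c
        bs]])
  have le: "cmod (iter_partial bs (fourier_series (tail_coeffs n c)) x) \<le> suminf g - sum g {..<n}"
      for n x
  proof -
    have rd: "rapidly_decreasing (\<lambda>\<eta>. deriv_symbol bs \<eta> * tail_coeffs n c \<eta>)"
      by (intro rapidly_decreasing_deriv_symbol rapidly_decreasing_tail_coeffs c bs)
    have "cmod (iter_partial bs (fourier_series (tail_coeffs n c)) x)
       \<le> (\<Sum>k. cmod (deriv_symbol bs (freq k) * tail_coeffs n c (freq k)))"
      unfolding iter_partial_fourier_series[OF rapidly_decreasing_tail_coeffs[OF c] bs]
      by (rule norm_fourier_series_le[OF rd])
    also have "\<dots> = (\<Sum>k. cmod (deriv_symbol bs (freq (k + n)) * tail_coeffs n c (freq (k + n))))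
        + (\<Sum>k<n. cmod (deriv_symbol bs (freq k) * tail_coeffs n c (freq k)))"
      by (rule suminf_split_initial_segment[OF summable_rapidly_decreasing[OF rd]])
    also have "\<dots> = (\<Sum>k. g (k + n))"
      by (simp add: g_def)
    also have "\<dots> = suminf g - sum g {..<n}"
      by (rule suminf_minus_initial_segment[OF g])
    finally show ?thesis .
  qed
  show "uniform_limit UNIV (\<lambda>n. iter_partial bs (fourier_series (tail_coeffs n c))) (\<lambda>_. 0)
      sequentially"
  proof (rule uniform_limitI)
    fix e :: real assume "e > 0"
    then have "\<forall>\<^sub>F n in sequentially. suminf g - sum g {..<n} < e"
      using suminf_minus_partial_sum_tendsto_0[OF g] by (simp add: order_tendsto_iff)
    then show "\<forall>\<^sub>F n in sequentially. \<forall>x\<in>UNIV. dist (iter_partial bs (fourier_series (tail_coeffs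
        n c)) x) 0 < e"
      proof eventually_elim
      case (elim n)
      show ?case using order.strict_trans1[OF le elim] by simp
    qed
  qed
qed

text \<open>Linearity peels off one character at a time, and sequential continuity at zero disposes
  of the remainder. The result is the device for exchanging a functional with an infinite
  sum.\<close>

lemma distribution_fourier_series_sums:
  assumes u: "u \<in> distributions" and c: "rapidly_decreasing c"
  shows "(\<lambda>k. c (freq k) * u (\<lambda>x. cis (x \<bullet> freq k))) sums u (fourier_series c)"
proof -
  have add: "u (\<lambda>x. \<phi> x + \<psi> x) = u \<phi> + u \<psi>" if "\<phi> \<in> Cinf_torus" "\<psi> \<in> Cinf_torus" for \<phi> \<psi>
    using u that by (simp add: distributions_def)
  have scale: "u (\<lambda>x. a * \<phi> x) = a * u \<phi>" if "\<phi> \<in> Cinf_torus" for a \<phi>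
    using u that by (simp add: distributions_def)
  have step: "u (fourier_series (tail_coeffs n c))
      = c (freq n) * u (\<lambda>x. cis (x \<bullet> freq n)) + u (fourier_series (tail_coeffs (Suc n) c))" for n
  proof -
    have "fourier_series (tail_coeffs n c)
        = (\<lambda>x. c (freq n) * cis (x \<bullet> freq n) + fourier_series (tail_coeffs (Suc n) c) x)"
      by (rule ext) (rule fourier_series_tail_Suc[OF c])
    then show ?thesis
      using add[OF character_Cinf[OF freq_in_lattice] fourier_series_Cinf[OF
          rapidly_decreasing_tail_coeffs[OF c]]]
      using scale[of "\<lambda>x. cis (x \<bullet> freq n)" "c (freq n)"] character_Cinf[OF freq_in_lattice, of 1
          n] by simp
  qed
  have eq: "(\<Sum>k<n. c (freq k) * u (\<lambda>x. cis (x \<bullet> freq k)))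
      = u (fourier_series c) - u (fourier_series (tail_coeffs n c))" for n
  proof (induction n)
    case (Suc n)
    then show ?case using step[of n] by (simp add: algebra_simps)
  qed (simp add: fourier_series_tail_0)
  have "(\<lambda>n. u (fourier_series (tail_coeffs n c))) \<longlonglongrightarrow> 0"
    using u fourier_series_tail_null_seq[OF c] by (simp add: distributions_def)
  from tendsto_diff[OF tendsto_const[of "u (fourier_series c)"] this]
  show ?thesis
    by (simp add: sums_def eq)
qed


section \<open>Fourier integrals of smooth functions\<close>

abbreviation torus_cube :: "'a::euclidean_space set" where
  "torus_cube \<equiv> cbox 0 ((2 * pi) *\<^sub>R One)"

lemma mem_torus_slab:
  fixes b :: "'a::euclidean_space"
  assumes "b \<in> Basis"
  shows "x \<in> cbox (s *\<^sub>R b) ((2 * pi) *\<^sub>R One + r *\<^sub>R b) \<longleftrightarrow>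
    (\<forall>i\<in>Basis - {b}. 0 \<le> x \<bullet> i \<and> x \<bullet> i \<le> 2 * pi) \<and> s \<le> x \<bullet> b \<and> x \<bullet> b \<le> 2 * pi + r"
  using assms by (auto simp: mem_box inner_add_left inner_Basis split: if_splits)

text \<open>The slab with side \<open>[0, 2 * pi + t]\<close> along \<open>b\<close> is cut at
  \<open>2 * pi\<close> and at \<open>t\<close>. The end pieces \<open>[0, t]\<close> and
  \<open>[2 * pi, 2 * pi + t]\<close> have equal integrals by periodicity, hence so do the cube and
  its translate.\<close>

lemma integral_torus_cube_translate:
  fixes f :: "'a::euclidean_space \<Rightarrow> complex"
  assumes per: "torus_periodic f" and cont: "continuous_on UNIV f"
    and b: "b \<in> Basis" and t: "0 \<le> t" "t \<le> 2 * pi"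
  shows "integral torus_cube (\<lambda>x. f (x + t *\<^sub>R b)) = integral torus_cube f"
proof -
  \<comment> \<open>The parameters are offsets of the two end faces: the side along \<open>b\<close>
    becomes \<open>[s, 2 * pi + r]\<close>.\<close>
  define slab where "slab = (\<lambda>s r. cbox (s *\<^sub>R b) ((2 * pi) *\<^sub>R One + r *\<^sub>R b))"
  have int: "(f has_integral integral (slab s r) f) (slab s r)" for s r
    unfolding slab_def using cont by (intro integrable_integral integrable_continuous
        continuous_on_subset[OF cont]) auto
  have cut: "slab 0 t \<inter> {x. x \<bullet> b \<le> 2 * pi} = slab 0 0" "slab 0 t \<inter> {x. x \<bullet> b \<ge> 2 * pi} = slab (2
      * pi) t"
    "slab 0 t \<inter> {x. x \<bullet> b \<le> t} = slab 0 (t - 2 * pi)" "slab 0 t \<inter> {x. x \<bullet> b \<ge> t} = slab t t"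
    unfolding slab_def set_eq_iff Int_iff mem_torus_slab[OF b] mem_Collect_eq using t by auto
  have split: "integral (slab 0 t) f = integral (slab 0 t \<inter> {x. x \<bullet> b \<le> c}) f
      + integral (slab 0 t \<inter> {x. x \<bullet> b \<ge> c}) f"
    if "c \<in> {t, 2 * pi}" for c
  proof (rule integral_unique)
    have "(f has_integral integral (slab 0 t \<inter> {x. x \<bullet> b \<le> c}) f) (slab 0 t \<inter> {x. x \<bullet> b \<le> c})"
      "(f has_integral integral (slab 0 t \<inter> {x. x \<bullet> b \<ge> c}) f) (slab 0 t \<inter> {x. x \<bullet> b \<ge> c})"
      using that by (auto simp: cut int)
    from has_integral_split[OF this[unfolded slab_def] b]
    show "(f has_integral integral (slab 0 t \<inter> {x. x \<bullet> b \<le> c}) f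
        + integral (slab 0 t \<inter> {x. x \<bullet> b \<ge> c}) f) (slab 0 t)"
      unfolding slab_def .
  qed
  have "integral (slab (2 * pi) t) f = integral (slab 0 (t - 2 * pi)) (f \<circ> (+) ((2 * pi) *\<^sub>R b))"
    unfolding slab_def integral_shift_cbox_plus by (simp add: algebra_simps)
  also have "f \<circ> (+) ((2 * pi) *\<^sub>R b) = f"
    using per b by (auto simp: torus_periodic_def add.commute)
  finally have "integral (slab t t) f = integral (slab 0 0) f"
    using split[of t] split[of "2 * pi"] by (simp add: cut)
  moreover have "integral (slab t t) f = integral torus_cube (f \<circ> (+) (t *\<^sub>R b))"
    unfolding slab_def integral_shift_cbox_plus by simp
  ultimately show ?thesis
    by (simp add: slab_def o_def add.commute)
qed

text \<open>Differentiating the integral over the translated cube, which does not depend on the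
  translation, replaces integration by parts and Fubini.\<close>

lemma integral_torus_cube_derivative:
  fixes f :: "'a::euclidean_space \<Rightarrow> complex"
  assumes per: "torus_periodic f"
    and D: "\<And>x. (f has_derivative D x) (at x)"
    and cont: "continuous_on UNIV (\<lambda>x. D x b)" and b: "b \<in> Basis"
  shows "integral torus_cube (\<lambda>x. D x b) = 0"
proof -
  have cont_f: "continuous_on UNIV f"
    using D by (meson differentiable_def differentiable_imp_continuous_on differentiable_on_def
        has_derivative_at_withinI)
  \<comment> \<open>Translation invariance is available for \<open>0 \<le> t \<le> 2 * pi\<close>,
    so the derivative in \<open>t\<close> is taken one-sidedly at 0.\<close>
  define U where "U = {0..2 * pi}"
  have vd: "((\<lambda>t. f (x + t *\<^sub>R b)) has_vector_derivative D (x + t *\<^sub>R b) b) (at t within U)" for x t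
  proof -
    have lin: "((\<lambda>t. x + t *\<^sub>R b) has_derivative (\<lambda>h. h *\<^sub>R b)) (at t within U)"
      by (auto intro!: derivative_eq_intros)
    have "((\<lambda>t. f (x + t *\<^sub>R b)) has_derivative (\<lambda>h. D (x + t *\<^sub>R b) (h *\<^sub>R b))) (at t within U)"
      by (rule has_derivative_compose[OF lin D])
    then show ?thesis
      by (simp add: has_vector_derivative_def linear_cmul[OF has_derivative_linear[OF D]])
  qed
  have "((\<lambda>t. integral torus_cube (\<lambda>x. f (x + t *\<^sub>R b))) has_vector_derivative
      integral torus_cube (\<lambda>x. D (x + 0 *\<^sub>R b) b)) (at 0 within U)"
  proof (rule leibniz_rule_vector_derivative)
    show "(\<lambda>x. f (x + t *\<^sub>R b)) integrable_on torus_cube" for t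
      by (intro integrable_continuous continuous_intros continuous_on_compose2[OF cont_f]) auto
    show "continuous_on (U \<times> torus_cube) (\<lambda>(t, x). D (x + t *\<^sub>R b) b)"
      unfolding case_prod_unfold
      by (intro continuous_on_compose2[OF cont] continuous_intros) auto
  qed (auto simp: U_def vd[unfolded U_def])
  moreover have "((\<lambda>t. integral torus_cube (\<lambda>x. f (x
      + t *\<^sub>R b))) has_vector_derivative 0) (at 0 within U)"
    by (rule has_vector_derivative_transform[OF _ _ has_vector_derivative_const[of "integral
        torus_cube f"]])
       (auto simp: U_def integral_torus_cube_translate[OF per cont_f b])
  \<comment> \<open>Uniqueness of the derivative within \<open>U\<close> requires 0 to be a limit
    point of \<open>U\<close>.\<close>
  moreover have "at (0::real) within U \<noteq> bot"
    unfolding U_def by (simp add: at_within_Icc_at_right trivial_limit_at_right_real)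
  ultimately have "integral torus_cube (\<lambda>x. D (x + 0 *\<^sub>R b) b) = 0"
    using vector_derivative_unique_within by blast
  then show ?thesis by simp
qed

section \<open>Fourier integrals and their decay\<close>

lemma Cinf_has_derivative:
  assumes "\<phi> \<in> Cinf_torus"
  shows "(\<phi> has_derivative frechet_derivative \<phi> (at x)) (at x)"
proof -
  have "iter_partial [] \<phi> differentiable_on UNIV"
    using assms unfolding Cinf_torus_def by blast
  then have "\<phi> differentiable (at x)"
    by (simp add: iter_partial_def differentiable_on_def)
  then show ?thesis by (simp add: frechet_derivative_works)
qed

lemma Cinf_continuous_on: "\<phi> \<in> Cinf_torus \<Longrightarrow> continuous_on S \<phi>"
  by (intro continuous_at_imp_continuous_on ballI has_derivative_continuous[OF Cinf_has_derivative])

text \<open>The fold applies the last direction of the list first. Replacing a function by its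
  derivative therefore appends to the list.\<close>

lemma iter_partial_snoc: "iter_partial (bs @ [b]) \<phi> = iter_partial bs (partial_deriv b \<phi>)"
  by (simp add: iter_partial_def)

lemma partial_deriv_Cinf:
  fixes \<phi> :: "'a::euclidean_space \<Rightarrow> complex"
  assumes \<phi>: "\<phi> \<in> Cinf_torus" and b: "b \<in> Basis"
  shows "partial_deriv b \<phi> \<in> Cinf_torus"
proof -
  have "frechet_derivative \<phi> (at (x + (2 * pi) *\<^sub>R i)) = frechet_derivative \<phi> (at x)"
      if i: "i \<in> Basis" for x i
  proof -
    have "((\<lambda>y. y + (2 * pi) *\<^sub>R i) has_derivative (\<lambda>h. h)) (at x)"
      by (auto intro!: derivative_eq_intros)
    from has_derivative_compose[OF this Cinf_has_derivative[OF \<phi>]]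
    have "((\<lambda>y. \<phi> (y + (2 * pi) *\<^sub>R i)) has_derivative frechet_derivative \<phi> (at (x + (2
        * pi) *\<^sub>R i))) (at x)" .
    moreover have "(\<lambda>y. \<phi> (y + (2 * pi) *\<^sub>R i)) = \<phi>"
      using \<phi> i by (auto simp: Cinf_torus_def torus_periodic_def)
    ultimately show ?thesis
      by (intro frechet_derivative_at) simp
  qed
  then have "torus_periodic (partial_deriv b \<phi>)"
    by (simp add: torus_periodic_def partial_deriv_def)
  moreover have "iter_partial bs (partial_deriv b \<phi>) differentiable_on UNIV" if "bs \<in> lists Basis"
      for bs
  proof -
    have "bs @ [b] \<in> lists Basis" using that b by simp
    then show ?thesis
      using \<phi> unfolding Cinf_torus_def iter_partial_snoc[symmetric] by blast
  qed
  ultimately show ?thesis by (simp add: Cinf_torus_def)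
qed

text \<open>Left without the factor \<open>(2 * pi)^(-N)\<close>, which keeps the estimates free of
  constants; the factor is restored at inversion.\<close>

definition fourier_integral :: "('a::euclidean_space \<Rightarrow> complex) \<Rightarrow> 'a \<Rightarrow> complex" where
  "fourier_integral \<phi> \<eta> = integral torus_cube (\<lambda>x. \<phi> x * cis (- (x \<bullet> \<eta>)))"

text \<open>The product of \<open>\<phi>\<close> with a lattice character is periodic, so its
  derivative integrates to zero; the product rule splits that integral into the two sides.\<close>

lemma fourier_integral_partial_deriv:
  assumes \<phi>: "\<phi> \<in> Cinf_torus" and b: "b \<in> Basis" and \<eta>: "\<eta> \<in> torus_lattice"
  shows "fourier_integral (partial_deriv b \<phi>) \<eta> = \<i> * of_real (\<eta> \<bullet> b) * fourier_integral \<phi> \<eta>"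
proof -
  define F where "F = (\<lambda>x. \<phi> x * cis (x \<bullet> (- \<eta>)))"
  define D where "D = (\<lambda>x h. frechet_derivative \<phi> (at x) h * cis (- (x \<bullet> \<eta>)) - \<i> * of_real (h \<bullet> \<eta>)
      * (\<phi> x * cis (- (x \<bullet> \<eta>))))"
  note [continuous_intros] = Cinf_continuous_on[OF \<phi>] Cinf_continuous_on[OF partial_deriv_Cinf[OF
      \<phi> b]]
  have per: "torus_periodic F"
    unfolding torus_periodic_def
  proof (intro ballI allI)
    fix i x :: 'a assume i: "i \<in> Basis"
    have "\<phi> (x + (2 * pi) *\<^sub>R i) = \<phi> x"
      using \<phi> i by (simp add: Cinf_torus_def torus_periodic_def)
    moreover have "cis ((x + (2 * pi) *\<^sub>R i) \<bullet> (- \<eta>)) = cis (x \<bullet> (- \<eta>))"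
      by (rule cis_inner_add_period) (use \<eta> i in auto)
    ultimately show "F (x + (2 * pi) *\<^sub>R i) = F x"
      unfolding F_def by simp
  qed
  have D: "(F has_derivative D x) (at x)" for x
    unfolding F_def D_def
    by (rule derivative_eq_intros Cinf_has_derivative[OF \<phi>] refl)+ (auto simp: fun_eq_iff
        algebra_simps scaleR_conv_of_real)
  have Db: "D x b = partial_deriv b \<phi> x * cis (- (x \<bullet> \<eta>)) - \<i> * of_real (b \<bullet> \<eta>) * (\<phi> x
      * cis (- (x \<bullet> \<eta>)))" for x
    by (simp add: D_def partial_deriv_def)
  have "integral torus_cube (\<lambda>x. D x b) = 0"
    by (rule integral_torus_cube_derivative[OF per D _ b]) (auto simp: Db intro!: continuous_intros)
  moreover have "integral torus_cube (\<lambda>x. D x b)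
    = fourier_integral (partial_deriv b \<phi>) \<eta> - \<i> * of_real (b \<bullet> \<eta>) * fourier_integral \<phi> \<eta>"
    unfolding Db fourier_integral_def
    by (subst integral_diff) (auto intro!: integrable_continuous continuous_intros)
  ultimately show ?thesis by (simp add: inner_commute)
qed

lemma norm_integral_cbox_le:
  fixes f :: "'a::euclidean_space \<Rightarrow> 'b::banach"
  assumes "continuous_on (cbox a b) f" "0 \<le> M" "\<And>x. x \<in> cbox a b \<Longrightarrow> norm (f x) \<le> M"
  shows "norm (integral (cbox a b) f) \<le> M * measure lborel (cbox a b)"
  using assms(2,3) by (rule has_integral_bound[OF _ integrable_integral[OF
      integrable_continuous[OF assms(1)]]])

text \<open>\<open>C\<close> and \<open>D\<close> depend on \<open>K\<close> alone, not on
  \<open>\<phi>\<close>. This uniformity gives continuity of functionals defined by coefficients.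
  Each further power of \<open>1 + norm \<eta>\<close> is exchanged for first partial derivatives
  through the coordinates of \<open>\<eta>\<close>.\<close>

lemma fourier_integral_decay:
  fixes K :: nat
  shows "\<exists>C D. 0 \<le> C \<and> finite D \<and> D \<subseteq> lists (Basis :: 'a::euclidean_space set) \<and>
    (\<forall>\<phi>\<in>Cinf_torus. \<forall>M\<ge>0. (\<forall>bs\<in>D. \<forall>x\<in>torus_cube. cmod (iter_partial bs \<phi> x) \<le> M) \<longrightarrow>
      (\<forall>\<eta>\<in>torus_lattice. cmod (fourier_integral \<phi> \<eta>) * (1 + norm \<eta>) ^ K \<le> C * M))"
proof (induction K)
  case 0
  show ?case
  proof (intro exI conjI ballI allI impI)
    show "{[]} \<subseteq> lists (Basis :: 'a set)" by simp
    fix \<phi> :: "'a \<Rightarrow> complex" and M \<eta>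
    assume \<phi>: "\<phi> \<in> Cinf_torus" and "0 \<le> M" and M: "\<forall>bs\<in>{[]}. \<forall>x\<in>torus_cube. cmod (iter_partial bs
        \<phi> x) \<le> M"
    have "cmod (fourier_integral \<phi> \<eta>) \<le> M * measure lborel (torus_cube :: 'a set)"
      unfolding fourier_integral_def using \<open>0 \<le> M\<close> M
      by (intro norm_integral_cbox_le continuous_intros Cinf_continuous_on[OF \<phi>])
         (auto simp: norm_mult iter_partial_def)
    then show "cmod (fourier_integral \<phi> \<eta>) * (1 + norm \<eta>) ^ 0
        \<le> measure lborel (torus_cube :: 'a set) * M"
      by (simp add: mult.commute)
  qed auto
next
  case (Suc K)
  then obtain C D where C: "0 \<le> C" and D: "finite D" "D \<subseteq> lists (Basis :: 'a set)"
    and IH: "\<And>\<phi> M \<eta>. \<phi> \<in> Cinf_torus \<Longrightarrow> 0 \<le> M \<Longrightarrow> (\<And>bs x. bs \<in> D \<Longrightarrow> x \<in> torus_cube \<Longrightarrow>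
        cmod (iter_partial bs \<phi> x) \<le> M) \<Longrightarrow>
      \<eta> \<in> torus_lattice \<Longrightarrow> cmod (fourier_integral \<phi> \<eta>) * (1 + norm \<eta>) ^ K \<le> C * M"
    by metis
  \<comment> \<open>The old lists serve the summand 1 of the weight; the lists extended by
    \<open>b\<close> serve the induction hypothesis applied to
    \<open>partial_deriv b \<phi>\<close>.\<close>
  define D' where "D' = D \<union> (\<Union>b\<in>Basis. (\<lambda>bs. bs @ [b]) ` D)"
  show ?case
  proof (intro exI conjI ballI allI impI)
    show "0 \<le> (1 + real DIM('a)) * C" using C by simp
    show "finite D'" using D by (auto simp: D'_def)
    show "D' \<subseteq> lists (Basis :: 'a set)" by (auto simp: D'_def dest!: subsetD[OF D(2)])
    fix \<phi> :: "'a \<Rightarrow> complex" and M and \<eta> :: 'a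
    assume \<phi>: "\<phi> \<in> Cinf_torus" and M0: "0 \<le> M" and \<eta>: "\<eta> \<in> torus_lattice"
      and M: "\<forall>bs\<in>D'. \<forall>x\<in>torus_cube. cmod (iter_partial bs \<phi> x) \<le> M"
    define I where "I = cmod (fourier_integral \<phi> \<eta>) * (1 + norm \<eta>) ^ K"
    have I: "I \<le> C * M"
      unfolding I_def using M by (intro IH \<phi> \<eta> M0) (auto simp: D'_def)
    have Ib: "\<bar>\<eta> \<bullet> b\<bar> * I \<le> C * M" if b: "b \<in> Basis" for b
    proof -
      have "cmod (fourier_integral (partial_deriv b \<phi>) \<eta>) * (1 + norm \<eta>) ^ K \<le> C * M"
      proof (intro IH partial_deriv_Cinf \<phi> \<eta> M0 b)
        fix bs x assume "bs \<in> D" "x \<in> (torus_cube :: 'a set)"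
        then show "cmod (iter_partial bs (partial_deriv b \<phi>) x) \<le> M"
          using M b unfolding D'_def iter_partial_snoc[symmetric] by blast
      qed
      then show ?thesis
        by (simp add: fourier_integral_partial_deriv[OF \<phi> b \<eta>] norm_mult I_def mult_ac)
    qed
    have "cmod (fourier_integral \<phi> \<eta>) * (1 + norm \<eta>) ^ Suc K = (1 + norm \<eta>) * I"
      by (simp add: I_def mult_ac)
    also have "\<dots> \<le> (1 + (\<Sum>b\<in>Basis. \<bar>\<eta> \<bullet> b\<bar>)) * I"
      using norm_le_l1[of \<eta>] by (intro mult_right_mono) (auto simp: I_def)
    also have "\<dots> = I + (\<Sum>b\<in>Basis. \<bar>\<eta> \<bullet> b\<bar> * I)"
      by (simp add: algebra_simps sum_distrib_left)
    also have "\<dots> \<le> C * M + (\<Sum>b\<in>(Basis::'a set). C * M)"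
      by (intro add_mono I sum_mono Ib)
    also have "\<dots> = (1 + real DIM('a)) * C * M"
      by (simp add: algebra_simps)
    finally show "cmod (fourier_integral \<phi> \<eta>) * (1 + norm \<eta>) ^ Suc K \<le> (1 + real DIM('a)) * C * M" .
  qed
qed

lemma rapidly_decreasing_fourier_integral:
  fixes \<phi> :: "'a::euclidean_space \<Rightarrow> complex"
  assumes \<phi>: "\<phi> \<in> Cinf_torus"
  shows "rapidly_decreasing (fourier_integral \<phi>)"
  unfolding rapidly_decreasing_def
proof
  fix K
  obtain C D where D: "finite D" "D \<subseteq> lists (Basis :: 'a set)"
    and *: "\<And>\<phi> M \<eta>. \<phi> \<in> Cinf_torus \<Longrightarrow> 0 \<le> M \<Longrightarrow> (\<And>bs x. bs \<in> D \<Longrightarrow> x \<in> torus_cube \<Longrightarrow>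
        cmod (iter_partial bs \<phi> x) \<le> M) \<Longrightarrow>
      \<eta> \<in> torus_lattice \<Longrightarrow> cmod (fourier_integral \<phi> \<eta>) * (1 + norm \<eta>) ^ K \<le> C * M"
    using fourier_integral_decay[of K] by metis
  have "bounded (\<Union>bs\<in>D. iter_partial bs \<phi> ` torus_cube)"
  proof (intro bounded_UN ballI D(1))
    fix bs assume "bs \<in> D"
    then have "iter_partial bs \<phi> differentiable_on UNIV"
      using \<phi> D by (auto simp: Cinf_torus_def)
    then have "continuous_on torus_cube (iter_partial bs \<phi>)"
      using differentiable_imp_continuous_on continuous_on_subset by blast
    then show "bounded (iter_partial bs \<phi> ` torus_cube)"
      by (intro compact_imp_bounded compact_continuous_image) auto
  qed
  then obtain M where "0 < M" "\<And>bs x. bs \<in> D \<Longrightarrow> x \<in> torus_cube \<Longrightarrow> cmod (iter_partial bs \<phi> x) \<le> M"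
    unfolding bounded_pos by blast
  then show "\<exists>C. \<forall>\<eta>\<in>torus_lattice. cmod (fourier_integral \<phi> \<eta>) * (1 + norm \<eta>) ^ K \<le> C"
    using *[OF \<phi>, of M] by force
qed

text \<open>Continuity uses the null sequence condition for the empty list only: uniform convergence
  of the functions themselves passes through the integral over a compact cube.\<close>

lemma integral_distribution:
  fixes f :: "'a::euclidean_space \<Rightarrow> complex"
  assumes f: "continuous_on torus_cube f"
  shows "(\<lambda>\<phi>. integral torus_cube (\<lambda>x. f x * \<phi> x)) \<in> distributions"
proof -
  have int: "(\<lambda>x. f x * \<phi> x) integrable_on torus_cube" if "\<phi> \<in> Cinf_torus" for \<phi>
    by (intro integrable_continuous continuous_intros f Cinf_continuous_on[OF that])
  have "(\<lambda>k. integral torus_cube (\<lambda>x. f x * \<phi> k x)) \<longlonglongrightarrow> 0" if \<phi>: "Cinf_null_seq \<phi>" for \<phi>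
  proof -
    have "uniform_limit UNIV (\<lambda>k. iter_partial [] (\<phi> k)) (\<lambda>_. 0) sequentially"
      using \<phi> unfolding Cinf_null_seq_def by blast
    then have lim: "uniform_limit torus_cube \<phi> (\<lambda>_. 0) sequentially"
      by (auto simp: iter_partial_def intro: uniform_limit_on_subset)
    have "bounded (f ` torus_cube)"
      by (intro compact_imp_bounded compact_continuous_image f compact_cbox)
    then have "uniform_limit torus_cube (\<lambda>k x. f x * \<phi> k x) (\<lambda>x. f x * 0) sequentially"
      by (intro bounded_bilinear.bounded_uniform_limit[OF bounded_bilinear_mult]
          uniform_limit_const lim) (auto simp: image_constant_conv)
    moreover have cont: "continuous_on torus_cube (\<lambda>x. f x * \<phi> k x)" for k
    proof -
      have "\<phi> k \<in> Cinf_torus" using \<phi> by (simp add: Cinf_null_seq_def)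
      from Cinf_continuous_on[OF this] show ?thesis by (intro continuous_on_mult f)
    qed
    ultimately obtain I J where IJ: "\<And>k. ((\<lambda>x. f x * \<phi> k x) has_integral I k) torus_cube"
      "((\<lambda>x::'a. f x * 0) has_integral J) torus_cube" "I \<longlonglongrightarrow> J"
      by (rule uniform_limit_integral_cbox[OF _ _ sequentially_bot]) blast
    then have "J = 0" using has_integral_0_eq by auto
    moreover have "(\<lambda>k. integral torus_cube (\<lambda>x. f x * \<phi> k x)) = I"
      using IJ(1) by (intro ext integral_unique)
    ultimately show ?thesis using IJ(3) by simp
  qed
  then show ?thesis
    by (auto simp: distributions_def int distrib_left integral_add mult.left_commute)
qed

text \<open>For nonzero \<open>\<eta>\<close> the character is, up to a nonzero factor, its own
  partial derivative in some direction, so its integral vanishes.\<close>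

lemma integral_character:
  fixes \<eta> :: "'a::euclidean_space"
  assumes \<eta>: "\<eta> \<in> torus_lattice"
  shows "integral torus_cube (\<lambda>x. cis (x \<bullet> \<eta>)) = (if \<eta> = 0 then of_real ((2
      * pi) ^ DIM('a)) else 0)"
proof (cases "\<eta> = 0")
  case True
  then show ?thesis
    by (simp add: content_cbox power_mult_distrib scaleR_conv_of_real)
next
  case False
  then obtain b where b: "b \<in> Basis" "\<eta> \<bullet> b \<noteq> 0"
    using euclidean_all_zero_iff by blast
  have "fourier_integral (partial_deriv b (\<lambda>x. 1 * cis (x \<bullet> \<eta>))) 0 = 0"
    using fourier_integral_partial_deriv[OF character_Cinf[OF \<eta>] b(1), of 0 1] by simp
  moreover have "partial_deriv b (\<lambda>x. 1 * cis (x \<bullet> \<eta>)) x = \<i> * of_real (\<eta> \<bullet> b) * cis (x \<bullet> \<eta>)" for x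
  proof -
    have "((\<lambda>x. 1 * cis (x \<bullet> \<eta>)) has_derivative (\<lambda>h. \<i> * of_real (h \<bullet> \<eta>) * cis (x \<bullet> \<eta>))) (at x)"
      by (auto intro!: derivative_eq_intros simp: scaleR_conv_of_real)
    from frechet_derivative_at[OF this] show ?thesis
      by (metis partial_deriv_def inner_commute)
  qed
  ultimately show ?thesis
    using b False by (simp add: fourier_integral_def)
qed

text \<open>Integration against a character is itself a distribution, which legitimises integrating
  the series term by term; orthogonality leaves one term.\<close>

lemma fourier_integral_fourier_series:
  fixes c :: "'a::euclidean_space \<Rightarrow> complex"
  assumes c: "rapidly_decreasing c" and \<eta>: "\<eta> \<in> torus_lattice"
  shows "fourier_integral (fourier_series c) \<eta> = of_real ((2 * pi) ^ DIM('a)) * c \<eta>"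
proof -
  obtain j where j: "\<eta> = freq j"
    using \<eta> by (rule torus_lattice_freqE)
  define u where "u = (\<lambda>\<phi>. integral torus_cube (\<lambda>x::'a. cis (- (x \<bullet> \<eta>)) * \<phi> x))"
  have "u \<in> distributions"
    unfolding u_def by (intro integral_distribution continuous_intros)
  from distribution_fourier_series_sums[OF this c]
  have s: "(\<lambda>k. c (freq k) * u (\<lambda>x. cis (x \<bullet> freq k))) sums u (fourier_series c)" .
  define A :: complex where "A = of_real ((2 * pi) ^ DIM('a))"
  have uk: "c (freq k) * u (\<lambda>x. cis (x \<bullet> freq k)) = (if k = j then c (freq k) * A else 0)" for k
  proof -
    have "u (\<lambda>x. cis (x \<bullet> freq k)) = integral torus_cube (\<lambda>x. cis (x \<bullet> (freq k - \<eta>)))"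
      unfolding u_def by (simp add: cis_mult inner_diff_right)
    also have "\<dots> = (if freq k - \<eta> = 0 then A else 0)"
      unfolding A_def by (intro integral_character torus_lattice_diff \<eta> freq_in_lattice)
    finally show ?thesis by (simp add: j)
  qed
  have "u (fourier_series c) = c (freq j) * A"
    using s sums_single[of j "\<lambda>k. c (freq k) * A"] unfolding uk by (rule sums_unique2)
  then show ?thesis
    by (simp add: u_def fourier_integral_def j mult.commute A_def)
qed


section \<open>Fourier inversion\<close>

text \<open>If \<open>g x0\<close> were positive, a small box around \<open>x0\<close> would
  contribute at least a multiple of \<open>q' ^ n\<close> to the integral, while the negative part
  of the integrand lives where \<open>K\<close> is at most \<open>q < q'\<close>. The ratio tends to
  zero as \<open>n\<close> grows, a contradiction.\<close>

lemma nonpos_of_kernel_integrals_zero: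
  fixes g K :: "'a::euclidean_space \<Rightarrow> real"
  assumes g: "continuous_on (cbox a b) g" and K: "continuous_on (cbox a b) K"
    and K0: "\<And>x. x \<in> cbox a b \<Longrightarrow> 0 \<le> K x"
    and K1: "\<And>x. x \<in> cbox a b \<Longrightarrow> x \<noteq> x0 \<Longrightarrow> K x < 1"
    and Kx0: "K x0 = 1" and x0: "x0 \<in> box a b"
    and zero: "\<And>n. integral (cbox a b) (\<lambda>x. g x * K x ^ n) = 0"
  shows "g x0 \<le> 0"
proof (rule ccontr)
  assume "\<not> g x0 \<le> 0"
  define \<delta> where "\<delta> = g x0 / 2"
  have \<delta>: "0 < \<delta>" "\<delta> < g x0" using \<open>\<not> g x0 \<le> 0\<close> by (auto simp: \<delta>_def)
  have contbox: "continuous_on (box a b) g" "continuous_on (box a b) K"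
    using g K box_subset_cbox continuous_on_subset by blast+
  define U where "U = box a b \<inter> g -` {\<delta><..}"
  have U: "open U" "x0 \<in> U" "U \<subseteq> cbox a b"
    unfolding U_def using contbox \<delta> x0 box_subset_cbox[of a b]
        by (auto intro!: continuous_open_preimage)
  \<comment> \<open>Off the open set \<open>U\<close> the kernel attains its maximum by compactness,
    and this maximum is below 1 because the only peak \<open>x0\<close> lies in
    \<open>U\<close>.\<close>
  obtain q where q: "0 \<le> q" "q < 1" "\<And>x. x \<in> cbox a b - U \<Longrightarrow> K x \<le> q"
  proof (cases "cbox a b - U = {}")
    case False
    have "compact (cbox a b - U)"
      by (intro compact_diff U) simp
    moreover have "continuous_on (cbox a b - U) K"
      using K by (rule continuous_on_subset) auto
    ultimately obtain y where y: "y \<in> cbox a b - U" "\<forall>x\<in>cbox a b - U. K x \<le> K y"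
      using continuous_attains_sup[OF _ False] by blast
    then have "y \<noteq> x0" using U by blast
    with y show thesis using that[of "K y"] K0 K1 by auto
  qed (use that[of 0] in auto)
  \<comment> \<open>The midpoint of \<open>q\<close> and 1: large enough to beat \<open>q\<close>,
    small enough for \<open>K\<close> to exceed it near \<open>x0\<close>.\<close>
  define q' where "q' = (1 + q) / 2"
  have q': "0 < q'" "q < q'" "q' < 1" using q by (auto simp: q'_def)
  have "open (U \<inter> (box a b \<inter> K -` {q'<..}))"
    by (intro open_Int U continuous_open_preimage contbox) auto
  moreover have "x0 \<in> U \<inter> (box a b \<inter> K -` {q'<..})"
    using U x0 Kx0 q' by auto
  ultimately obtain v w where vw: "cbox v w \<subseteq> U \<inter> (box a b \<inter> K -` {q'<..})" "x0 \<in> box v w"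
    by (rule open_contains_cbox)
  define V where "V = measure lborel (cbox v w)"
  have V: "0 < V"
    unfolding V_def using vw(2) by (intro content_pos_lt) (auto simp: mem_box)
  have "bounded (g ` cbox a b)"
    by (intro compact_imp_bounded compact_continuous_image g compact_cbox)
  then obtain B where B: "0 < B" "\<And>x. x \<in> cbox a b \<Longrightarrow> \<bar>g x\<bar> \<le> B"
    unfolding bounded_pos by auto
  define W where "W = measure lborel (cbox a b)"
  have le: "V * \<delta> * q' ^ n \<le> W * B * q ^ n" for n
  proof -
    \<comment> \<open>A step function below the integrand in all three regions, with an explicit
      integral.\<close>
    define low where "low = (\<lambda>x. (if x \<in> cbox v w then \<delta> * q' ^ n else 0) - B * q ^ n)"
    have "cbox v w \<subseteq> cbox a b" using vw U by auto
    then have "((\<lambda>x. if x \<in> cbox v w then \<delta> * q' ^ n else 0) has_integral V * (\<delta>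
        * q' ^ n)) (cbox a b)"
      using has_integral_const[of "\<delta> * q' ^ n" v w]
          by (subst has_integral_restrict) (auto simp: V_def)
    moreover have "((\<lambda>x. B * q ^ n) has_integral W * (B * q ^ n)) (cbox a b)"
      using has_integral_const[of "B * q ^ n" a b] by (simp add: W_def)
    ultimately have "(low has_integral V * (\<delta> * q' ^ n) - W * (B * q ^ n)) (cbox a b)"
      unfolding low_def by (rule has_integral_diff)
    moreover have "((\<lambda>x. g x * K x ^ n) has_integral 0) (cbox a b)"
      using zero[of n] by (metis integrable_integral integrable_continuous continuous_on_mult
          continuous_on_power g K)
    moreover have "low x \<le> g x * K x ^ n" if x: "x \<in> cbox a b" for x
    proof -
      have Bq: "0 \<le> B * q ^ n" using B q by simp
      consider "x \<in> cbox v w" | "x \<notin> cbox v w" "x \<in> U" | "x \<notin> cbox v w" "x \<in> cbox a b - U"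
        using x by blast
      then show ?thesis
      proof cases
        case 1
        then have "\<delta> < g x" "q' < K x" using vw by (auto simp: U_def)
        then have "\<delta> * q' ^ n \<le> g x * K x ^ n"
          using \<delta> q' by (intro mult_mono power_mono) auto
        then show ?thesis using 1 Bq by (simp add: low_def)
      next
        case 2
        then have "0 \<le> g x * K x ^ n"
          using \<delta> K0[OF x] by (auto simp: U_def)
        then show ?thesis using 2 Bq by (simp add: low_def)
      next
        case 3
        have "- (g x * K x ^ n) \<le> \<bar>g x\<bar> * K x ^ n"
          using K0[OF x] by (metis abs_ge_minus_self mult_minus_left mult_right_mono zero_le_power)
        also have "\<dots> \<le> B * q ^ n"
          using 3 B K0[OF x] q by (intro mult_mono power_mono) auto
        finally show ?thesis using 3 by (simp add: low_def)
      qed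
    qed
    ultimately have "V * (\<delta> * q' ^ n) - W * (B * q ^ n) \<le> 0"
      by (rule has_integral_le)
    then show ?thesis by (simp add: mult.assoc)
  qed
  have "V * \<delta> \<le> W * B * (q / q') ^ n" for n
    using le[of n] q' by (simp add: power_divide field_simps)
  moreover have "(\<lambda>n. W * B * (q / q') ^ n) \<longlonglongrightarrow> W * B * 0"
    using q q' by (intro tendsto_intros LIMSEQ_power_zero) auto
  ultimately have "V * \<delta> \<le> W * B * 0"
    by (intro LIMSEQ_le_const) auto
  then show False using V \<delta> by (simp add: mult_le_0_iff)
qed

definition fourier_null :: "('a::euclidean_space \<Rightarrow> complex) \<Rightarrow> bool" where
  "fourier_null h \<longleftrightarrow> continuous_on UNIV h \<and> (\<forall>\<eta>\<in>torus_lattice. fourier_integral h \<eta> = 0)"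

text \<open>The cosine is a combination of two characters, so multiplication shifts frequencies by
  \<open>b\<close> and \<open>- b\<close>, which stay in the lattice.\<close>

lemma fourier_null_mult_cos:
  fixes h :: "'a::euclidean_space \<Rightarrow> complex"
  assumes h: "fourier_null h" and b: "b \<in> Basis"
  shows "fourier_null (\<lambda>x. h x * of_real ((1 + cos ((x - y) \<bullet> b)) / 2))"
proof -
  have cont: "continuous_on UNIV h" using h by (simp add: fourier_null_def)
  note [continuous_intros] = continuous_on_subset[OF cont subset_UNIV]
  have "fourier_integral (\<lambda>x. h x * of_real ((1 + cos ((x - y) \<bullet> b)) / 2)) \<eta> = 0"
      if \<eta>: "\<eta> \<in> torus_lattice" for \<eta>
  proof -
    define e where "e = (\<lambda>\<eta> x. h x * cis (- (x \<bullet> \<eta>)))"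
    have int: "(\<lambda>x. a * e \<xi> x) integrable_on torus_cube" for a \<xi>
      unfolding e_def by (intro integrable_continuous continuous_intros)
    have "complex_of_real (cos t) = (cis t + cis (- t)) / 2" for t
      by (simp add: complex_eq_iff)
    then have cosb: "complex_of_real (cos ((x - y) \<bullet> b)) = (cis (x \<bullet> b) * cis (- (y \<bullet> b))
        + cis (- (x \<bullet> b)) * cis (y \<bullet> b)) / 2" for x
      by (simp add: cis_mult inner_diff_left)
    have "h x * of_real ((1 + cos ((x - y) \<bullet> b)) / 2) * cis (- (x \<bullet> \<eta>))
      = 1 / 2 * e \<eta> x + (cis (- (y \<bullet> b)) / 4 * e (\<eta> - b) x + cis (y \<bullet> b) / 4 * e (\<eta> + b) x)" for x
    proof -
      have "cis (- (x \<bullet> (\<eta> - b))) = cis (x \<bullet> b) * cis (- (x \<bullet> \<eta>))" "cis (- (x \<bullet> (\<eta> + b)))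
          = cis (- (x \<bullet> b)) * cis (- (x \<bullet> \<eta>))"
        by (simp_all add: cis_mult inner_diff_right inner_add_right algebra_simps)
      then show ?thesis
        unfolding e_def of_real_divide of_real_add cosb by (simp add: field_simps)
    qed
    then have "fourier_integral (\<lambda>x. h x * of_real ((1 + cos ((x - y) \<bullet> b)) / 2)) \<eta>
      = integral torus_cube (\<lambda>x. 1 / 2 * e \<eta> x + (cis (- (y \<bullet> b)) / 4 * e (\<eta> - b) x
          + cis (y \<bullet> b) / 4 * e (\<eta> + b) x))"
      unfolding fourier_integral_def by presburger
    also have "\<dots> = 1 / 2 * integral torus_cube (e \<eta>) + (cis (- (y \<bullet> b)) / 4
        * integral torus_cube (e (\<eta> - b)) + cis (y \<bullet> b) / 4 * integral torus_cube (e (\<eta> + b)))"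
      by (subst integral_add[OF int integrable_add[OF int int]], subst integral_add[OF int int])
          simp
    also have "\<dots> = 0"
      using h \<eta> b unfolding fourier_null_def fourier_integral_def e_def
      by (simp add: torus_lattice_add torus_lattice_diff)
    finally show ?thesis .
  qed
  then show ?thesis
    unfolding fourier_null_def by (intro conjI ballI continuous_intros) auto
qed

lemma fourier_null_mult_kernel:
  assumes h: "fourier_null h"
  shows "fourier_null (\<lambda>x. h x * of_real ((\<Prod>b\<in>Basis. (1 + cos ((x - y) \<bullet> b)) / 2) ^ n))"
proof (induction n)
  case (Suc n)
  define H where "H = (\<lambda>x. h x * of_real ((\<Prod>b\<in>Basis. (1 + cos ((x - y) \<bullet> b)) / 2) ^ n))"
  have "finite B \<Longrightarrow> B \<subseteq> Basis \<Longrightarrow> fourier_null (\<lambda>x. H x * of_real (\<Prod>b\<in>B. (1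
      + cos ((x - y) \<bullet> b)) / 2))" for B
  proof (induction B rule: finite_induct)
    case empty
    then show ?case using Suc by (simp add: H_def)
  next
    case (insert b B)
    then have "fourier_null (\<lambda>x. H x * of_real (\<Prod>b\<in>B. (1 + cos ((x - y) \<bullet> b)) / 2))"
        and b: "b \<in> Basis"
      by auto
    from fourier_null_mult_cos[OF this, of y] show ?case
      using insert.hyps by (simp add: mult_ac)
  qed
  from this[OF finite_Basis order_refl] show ?case
    by (simp add: H_def mult_ac)
qed (use h in simp)

text \<open>Testing the real part of \<open>cnj (h y) * h x\<close> turns a one-sided bound into
  vanishing, since its value at \<open>y\<close> is the squared modulus of \<open>h y\<close>. For
  interior \<open>y\<close>, each coordinate of \<open>x - y\<close> is smaller than a period in
  modulus, so the kernel is 1 only at \<open>y\<close>.\<close>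

lemma fourier_null_eq_0_interior:
  fixes h :: "'a::euclidean_space \<Rightarrow> complex"
  assumes h: "fourier_null h" and y: "y \<in> box 0 ((2 * pi) *\<^sub>R One)"
  shows "h y = 0"
proof -
  define K where "K = (\<lambda>x. \<Prod>b\<in>Basis. (1 + cos ((x - y) \<bullet> b)) / 2)"
  define g where "g = (\<lambda>x. Re (cnj (h y) * h x))"
  have cont: "continuous_on S h" for S
    using h continuous_on_subset unfolding fourier_null_def by blast
  have "g y \<le> 0"
  proof (rule nonpos_of_kernel_integrals_zero[OF _ _ _ _ _ y])
    show "continuous_on torus_cube g" "continuous_on torus_cube K"
      unfolding g_def K_def by (intro continuous_intros cont; simp)+
    have f0: "0 \<le> (1 + cos t) / 2" for t :: real
    proof -
      have "0 \<le> 1 + cos t" using cos_ge_minus_one[of t] by linarith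
      then show ?thesis by simp
    qed
    have f1: "(1 + cos t) / 2 \<le> 1" for t :: real
      using cos_le_one[of t] by simp
    show "0 \<le> K x" for x
      unfolding K_def by (intro prod_nonneg ballI f0)
    show "K y = 1" by (simp add: K_def)
    show "K x < 1" if x: "x \<in> torus_cube" and "x \<noteq> y" for x
    proof -
      obtain b where b: "b \<in> Basis" "(x - y) \<bullet> b \<noteq> 0"
        using \<open>x \<noteq> y\<close> by (metis euclidean_all_zero_iff right_minus_eq)
      have "0 \<le> x \<bullet> b" "x \<bullet> b \<le> 2 * pi" "0 < y \<bullet> b" "y \<bullet> b < 2 * pi"
        using x y b by (auto simp: mem_box)
      then have lt: "\<bar>(x - y) \<bullet> b\<bar> < 2 * pi"
        by (simp add: inner_diff_left)
      have "cos ((x - y) \<bullet> b) \<noteq> 1"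
      proof
        assume "cos ((x - y) \<bullet> b) = 1"
        then obtain n :: int where n: "(x - y) \<bullet> b = of_int n * 2 * pi"
          by (auto simp: cos_one_2pi_int)
        then have "\<bar>real_of_int n\<bar> * (2 * pi) < 1 * (2 * pi)"
          using lt by (simp add: abs_mult)
        then have "\<bar>real_of_int n\<bar> < 1"
          using mult_less_cancel_right_pos[of "2 * pi"] by simp
        then have "n = 0" by linarith
        with n b show False by simp
      qed
      then have c: "(1 + cos ((x - y) \<bullet> b)) / 2 < 1"
        using cos_le_one[of "(x - y) \<bullet> b"] by (simp add: less_le)
      have "K x = (1 + cos ((x - y) \<bullet> b)) / 2 * (\<Prod>b\<in>Basis - {b}. (1 + cos ((x - y) \<bullet> b)) / 2)"
        unfolding K_def by (rule prod.remove) (use b in auto)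
      also have "\<dots> \<le> (1 + cos ((x - y) \<bullet> b)) / 2 * 1"
        by (intro mult_left_mono prod_le_1 f0 f1 conjI)
      finally show ?thesis using c by simp
    qed
    show "integral torus_cube (\<lambda>x. g x * K x ^ n) = 0" for n
    proof -
      define f where "f = (\<lambda>x. h x * of_real (K x ^ n))"
      have f: "fourier_null f"
        unfolding f_def K_def by (rule fourier_null_mult_kernel[OF h])
      then have "continuous_on torus_cube f"
        using continuous_on_subset unfolding fourier_null_def by blast
      moreover have "bounded_linear (\<lambda>z. Re (cnj (h y) * z))"
        by (intro bounded_linear_compose[OF bounded_linear_Re] bounded_linear_mult_right)
      ultimately have "integral torus_cube ((\<lambda>z. Re (cnj (h y) * z)) \<circ> f) = Re (cnj (h y)
          * integral torus_cube f)"
        by (intro integral_linear integrable_continuous)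
      moreover have "integral torus_cube f = fourier_integral f 0"
        by (simp add: fourier_integral_def)
      moreover have "fourier_integral f 0 = 0"
        using f by (simp add: fourier_null_def)
      moreover have "((\<lambda>z. Re (cnj (h y) * z)) \<circ> f) = (\<lambda>x. g x * K x ^ n)"
        by (auto simp: f_def g_def fun_eq_iff algebra_simps simp flip: of_real_power)
      ultimately show ?thesis by simp
    qed
  qed
  moreover have "g y = (cmod (h y))\<^sup>2"
    unfolding cmod_power2 by (simp add: g_def power2_eq_square)
  ultimately show ?thesis by simp
qed

section \<open>Reduction to the period cube, uniqueness and inversion\<close>

lemma torus_periodic_shift_int:
  assumes f: "torus_periodic f" and b: "b \<in> Basis"
  shows "f (x + (2 * pi * of_int n) *\<^sub>R b) = f x"
proof -
  have nat: "f (x + (2 * pi * of_nat k) *\<^sub>R b) = f x" for k x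
  proof (induction k)
    case (Suc k)
    have "x + (2 * pi * of_nat (Suc k)) *\<^sub>R b = (x + (2 * pi * of_nat k) *\<^sub>R b) + (2 * pi) *\<^sub>R b"
      by (simp add: algebra_simps)
    moreover have "f (z + (2 * pi) *\<^sub>R b) = f z" for z
      using f b by (simp add: torus_periodic_def)
    ultimately show ?case using Suc by presburger
  qed simp
  show ?thesis
  proof (cases "0 \<le> n")
    case True
    then show ?thesis using nat[of x "nat n"] by simp
  next
    case False
    \<comment> \<open>A negative shift is undone by a positive one, starting from the shifted
      point.\<close>
    then show ?thesis using nat[of "x + (2 * pi * of_int n) *\<^sub>R b" "nat (- n)"]
        by (simp add: algebra_simps)
  qed
qed

lemma torus_cube_representative:
  fixes x :: "'a::euclidean_space"
  obtains y where "y \<in> torus_cube" "\<And>f. torus_periodic f \<Longrightarrow> f y = f x"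
proof
  define n where "n = (\<lambda>b. - \<lfloor>x \<bullet> b / (2 * pi)\<rfloor>)"
  show "x + (\<Sum>b\<in>Basis. (2 * pi * of_int (n b)) *\<^sub>R b) \<in> torus_cube"
    unfolding mem_box
  proof
    fix b :: 'a assume b: "b \<in> Basis"
    have "0 \<le> x \<bullet> b / (2 * pi) + of_int (n b)"
      unfolding n_def of_int_minus by linarith
    moreover have "x \<bullet> b / (2 * pi) + of_int (n b) \<le> 1"
      unfolding n_def of_int_minus by linarith
    ultimately have "0 \<le> x \<bullet> b + 2 * pi * of_int (n b)" "x \<bullet> b + 2 * pi * of_int (n b) \<le> 2 * pi"
      by (simp_all add: field_simps)
    then show "0 \<bullet> b \<le> (x + (\<Sum>b\<in>Basis. (2 * pi * of_int (n b)) *\<^sub>R b)) \<bullet> b \<and>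
         (x + (\<Sum>b\<in>Basis. (2 * pi * of_int (n b)) *\<^sub>R b)) \<bullet> b \<le> ((2 * pi) *\<^sub>R One) \<bullet> b"
      using b by (simp add: inner_add_left)
  qed
  fix f :: "'a \<Rightarrow> complex" assume f: "torus_periodic f"
  have "finite B \<Longrightarrow> B \<subseteq> Basis \<Longrightarrow> f (x + (\<Sum>b\<in>B. (2 * pi * of_int (n b)) *\<^sub>R b)) = f x" for B
  proof (induction B rule: finite_induct)
    case (insert b B)
    then show ?case
      using torus_periodic_shift_int[OF f, of b "x + (\<Sum>b\<in>B. (2 * pi * of_int (n b)) *\<^sub>R b)" "n b"]
      by (simp add: algebra_simps)
  qed simp
  then show "f (x + (\<Sum>b\<in>Basis. (2 * pi * of_int (n b)) *\<^sub>R b)) = f x" by simp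
qed

text \<open>Every point has a representative in the closed cube, which is the closure of the open
  box where \<open>h\<close> is already known to vanish.\<close>

lemma fourier_null_eq_0:
  fixes h :: "'a::euclidean_space \<Rightarrow> complex"
  assumes h: "fourier_null h" and per: "torus_periodic h"
  shows "h x = 0"
proof -
  obtain y where y: "y \<in> torus_cube" "h y = h x"
    using torus_cube_representative per by metis
  have ne: "box 0 ((2 * pi) *\<^sub>R One) \<noteq> ({} :: 'a set)"
    by (simp add: box_ne_empty)
  have "h y = 0"
  proof (rule continuous_constant_on_closure[where f = h and x = y and S = "box 0 ((2
      * pi) *\<^sub>R One)"])
    show "continuous_on (closure (box 0 ((2 * pi) *\<^sub>R One))) h"
      using h continuous_on_subset unfolding fourier_null_def by blast
    show "y \<in> closure (box 0 ((2 * pi) *\<^sub>R One))"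
      using y closure_box[OF ne] by simp
  qed (rule fourier_null_eq_0_interior[OF h])
  with y show ?thesis by simp
qed

text \<open>The series built from the coefficients of \<open>\<phi>\<close> has the same
  coefficients by orthogonality, so uniqueness applies to the difference.\<close>

lemma fourier_inversion:
  fixes \<phi> :: "'a::euclidean_space \<Rightarrow> complex"
  assumes \<phi>: "\<phi> \<in> Cinf_torus"
  shows "\<phi> = fourier_series (\<lambda>\<eta>. fourier_integral \<phi> \<eta> / of_real ((2 * pi) ^ DIM('a)))"
    and "rapidly_decreasing (\<lambda>\<eta>. fourier_integral \<phi> \<eta> / of_real ((2 * pi) ^ DIM('a)))"
proof -
  define c where "c = (\<lambda>\<eta>. fourier_integral \<phi> \<eta> / of_real ((2 * pi) ^ DIM('a)))"
  have c: "rapidly_decreasing c"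
    by (rule rapidly_decreasing_dominated[OF rapidly_decreasing_fourier_integral[OF \<phi>], where B
        = "1 / (2 * pi) ^ DIM('a)" and p = 0])
      (simp add: c_def norm_divide norm_mult norm_power)
  have s: "fourier_series c \<in> Cinf_torus" by (rule fourier_series_Cinf[OF c])
  define h where "h = (\<lambda>x. \<phi> x - fourier_series c x)"
  have "fourier_integral h \<eta> = 0" if \<eta>: "\<eta> \<in> torus_lattice" for \<eta>
  proof -
    have "fourier_integral h \<eta> = fourier_integral \<phi> \<eta> - fourier_integral (fourier_series c) \<eta>"
      unfolding fourier_integral_def h_def left_diff_distrib
      by (intro integral_diff integrable_continuous continuous_intros Cinf_continuous_on[OF \<phi>]
          Cinf_continuous_on[OF s])
    then show ?thesis
      unfolding fourier_integral_fourier_series[OF c \<eta>] by (simp add: c_def)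
  qed
  then have "fourier_null h"
    unfolding fourier_null_def h_def by (intro conjI continuous_intros Cinf_continuous_on[OF \<phi>]
        Cinf_continuous_on[OF s]) auto
  moreover have "torus_periodic h"
    using \<phi> s by (simp add: h_def Cinf_torus_def torus_periodic_def)
  ultimately have "h x = 0" for x by (rule fourier_null_eq_0)
  then have "\<phi> = fourier_series c" by (auto simp: h_def)
  then show "\<phi> = fourier_series (\<lambda>\<eta>. fourier_integral \<phi> \<eta> / of_real ((2 * pi) ^ DIM('a)))"
    by (simp add: c_def)
  show "rapidly_decreasing (\<lambda>\<eta>. fourier_integral \<phi> \<eta> / of_real ((2 * pi) ^ DIM('a)))"
    using c by (simp add: c_def)
qed


section \<open>Distributions and their Fourier coefficients\<close>

lemma fourier_inversionE:
  fixes \<phi> :: "'a::euclidean_space \<Rightarrow> complex"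
  assumes "\<phi> \<in> Cinf_torus"
  obtains c where "rapidly_decreasing c" "\<phi> = fourier_series c"
  using fourier_inversion[OF assms] by blast

text \<open>Series are expanded in \<open>cis (x \<bullet> \<eta>)\<close> but coefficients test
  against the conjugate, hence the reflected frequency.\<close>

lemma fourier_coeff_eq:
  fixes u :: "('a::euclidean_space \<Rightarrow> complex) \<Rightarrow> complex"
  shows "u (\<lambda>x. cis (x \<bullet> \<eta>)) = of_real ((2 * pi) ^ DIM('a)) * fourier_coeff u (- \<eta>)"
  by (simp add: fourier_coeff_def)

text \<open>Both functionals sum the same series on a Fourier expansion. Agreement is claimed on
  smooth functions only, because other values are arbitrary.\<close>

lemma distributions_eqI:
  assumes u: "u \<in> distributions" and v: "v \<in> distributions"
    and eq: "\<And>\<eta>. \<eta> \<in> torus_lattice \<Longrightarrow> fourier_coeff u \<eta> = fourier_coeff v \<eta>"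
    and \<phi>: "\<phi> \<in> Cinf_torus"
  shows "u \<phi> = v \<phi>"
proof -
  obtain c where c: "rapidly_decreasing c" "\<phi> = fourier_series c"
    using \<phi> by (rule fourier_inversionE)
  have "u (\<lambda>x. cis (x \<bullet> freq k)) = v (\<lambda>x. cis (x \<bullet> freq k))" for k
    unfolding fourier_coeff_eq by (simp add: eq)
  then show ?thesis
    using distribution_fourier_series_sums[OF u c(1)] distribution_fourier_series_sums[OF v c(1)]
        c(2)
    by (simp add: sums_unique2)
qed

lemma fourier_coeff_integral:
  fixes f :: "'a::euclidean_space \<Rightarrow> complex"
  assumes "\<And>\<phi>. \<phi> \<in> Cinf_torus \<Longrightarrow> u \<phi> = integral torus_cube (\<lambda>x. f x * \<phi> x)" "\<eta> \<in> torus_lattice"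
  shows "fourier_coeff u \<eta> = fourier_integral f \<eta> / of_real ((2 * pi) ^ DIM('a))"
proof -
  have "(\<lambda>x. cis (- (x \<bullet> \<eta>))) \<in> Cinf_torus"
    using character_Cinf[of "- \<eta>" 1] assms(2) by simp
  then show ?thesis
    by (simp add: fourier_coeff_def fourier_integral_def assms(1))
qed

text \<open>Conversely to inversion, rapidly decreasing coefficients sum to a smooth density, and
  integration against it has the same coefficients as \<open>u\<close>.\<close>

lemma smooth_distributions_iff:
  fixes u :: "('a::euclidean_space \<Rightarrow> complex) \<Rightarrow> complex"
  assumes u: "u \<in> distributions"
  shows "u \<in> smooth_distributions \<longleftrightarrow> rapidly_decreasing (fourier_coeff u)"
proof
  assume "u \<in> smooth_distributions"
  then obtain f where f: "f \<in> Cinf_torus" "\<And>\<phi>. \<phi> \<in> Cinf_torus \<Longrightarrow> u \<phi> = integral torus_cube (\<lambda>x. f x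
      * \<phi> x)"
    unfolding smooth_distributions_def by blast
  show "rapidly_decreasing (fourier_coeff u)"
    by (rule rapidly_decreasing_dominated[OF fourier_inversion(2)[OF f(1)], where B = 1 and p = 0])
       (simp add: fourier_coeff_integral[OF f(2)])
next
  assume c: "rapidly_decreasing (fourier_coeff u)"
  define f where "f = fourier_series (fourier_coeff u)"
  define v where "v = (\<lambda>\<phi>. integral torus_cube (\<lambda>x. f x * \<phi> x))"
  have f: "f \<in> Cinf_torus" unfolding f_def by (rule fourier_series_Cinf[OF c])
  have v: "v \<in> distributions" unfolding v_def
      by (rule integral_distribution[OF Cinf_continuous_on[OF f]])
  have "fourier_coeff u \<eta> = fourier_coeff v \<eta>" if \<eta>: "\<eta> \<in> torus_lattice" for \<eta>
  proof -
    have "fourier_coeff v \<eta> = fourier_integral f \<eta> / of_real ((2 * pi) ^ DIM('a))"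
      by (rule fourier_coeff_integral[OF _ \<eta>]) (simp add: v_def)
    also have "\<dots> = fourier_coeff u \<eta>"
      unfolding f_def fourier_integral_fourier_series[OF c \<eta>] by simp
    finally show ?thesis by simp
  qed
  then have "u \<phi> = v \<phi>" if "\<phi> \<in> Cinf_torus" for \<phi>
    using distributions_eqI[OF u v] that by blast
  then show "u \<in> smooth_distributions"
    using u f unfolding smooth_distributions_def v_def by blast
qed

text \<open>The functional is the Parseval pairing. Bounded coefficients against Fourier integrals
  decaying at order \<open>2 * DIM('a)\<close> give absolute convergence, and the uniform decay
  estimate gives continuity.\<close>

lemma distribution_with_bounded_coeffs:
  fixes c :: "'a::euclidean_space \<Rightarrow> complex"
  assumes bd: "\<And>\<eta>. \<eta> \<in> torus_lattice \<Longrightarrow> cmod (c \<eta>) \<le> B"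
  obtains u where "u \<in> distributions" "\<And>\<eta>. \<eta> \<in> torus_lattice \<Longrightarrow> fourier_coeff u \<eta> = c \<eta>"
proof
  define u where "u = (\<lambda>\<phi> :: 'a \<Rightarrow> complex. \<Sum>k. c (freq k) * fourier_integral \<phi> (- freq k))"
  define w where "w = (\<lambda>k. 1 / (1 + norm (freq k :: 'a)) ^ (2 * DIM('a)))"
  have w: "summable w" "\<And>k. 0 \<le> w k"
    unfolding w_def by (auto intro!: summable_freq_weight)
  have B: "0 \<le> B" using bd[OF torus_lattice_zero] norm_ge_zero order_trans by blast
  have bound: "cmod (c (freq k) * fourier_integral \<phi> (- freq k)) \<le> B * L * w k"
    if "cmod (fourier_integral \<phi> (- freq k)) * (1 + norm (- freq k :: 'a)) ^ (2 * DIM('a)) \<le> L"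
        for k and \<phi> :: "'a \<Rightarrow> complex" and L
  proof -
    have pos: "0 < (1 + norm (freq k :: 'a)) ^ (2 * DIM('a))"
      by (intro zero_less_power add_pos_nonneg) auto
    then have "cmod (fourier_integral \<phi> (- freq k)) \<le> L * w k"
      using that by (simp add: w_def field_simps)
    then have "cmod (c (freq k)) * cmod (fourier_integral \<phi> (- freq k)) \<le> B * (L * w k)"
      using bd B by (intro mult_mono) auto
    then show ?thesis by (simp add: norm_mult mult.assoc)
  qed
  have sm: "summable (\<lambda>k. c (freq k) * fourier_integral \<phi> (- freq k))" if \<phi>: "\<phi> \<in> Cinf_torus"
      for \<phi> :: "'a \<Rightarrow> complex"
  proof -
    obtain L where L: "\<And>\<eta>. \<eta> \<in> torus_lattice \<Longrightarrow> cmod (fourier_integral \<phi> \<eta>) * (1 + norm \<eta>) ^ (2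
        * DIM('a)) \<le> L"
      using rapidly_decreasing_fourier_integral[OF \<phi>] unfolding rapidly_decreasing_def by meson
    have "cmod (c (freq k) * fourier_integral \<phi> (- freq k)) \<le> B * L * w k" for k
      by (intro bound L) simp
    then show ?thesis
      by (intro summable_comparison_test'[OF summable_mult[OF w(1), of "B * L"]]) auto
  qed
  have lim: "(\<lambda>k. u (\<phi> k)) \<longlonglongrightarrow> 0" if \<phi>: "Cinf_null_seq \<phi>" for \<phi>
  proof (rule LIMSEQ_I)
    fix e :: real assume e: "0 < e"
    have \<phi>C: "\<phi> k \<in> Cinf_torus" for k using \<phi> by (simp add: Cinf_null_seq_def)
    obtain C D where C: "0 \<le> C" and D: "finite D" "D \<subseteq> lists (Basis :: 'a set)"
      and *: "\<And>\<phi> M \<eta>. \<phi> \<in> Cinf_torus \<Longrightarrow> 0 \<le> M \<Longrightarrow> (\<And>bs x. bs \<in> D \<Longrightarrow> x \<in> torus_cube \<Longrightarrow>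
          cmod (iter_partial bs \<phi> x) \<le> M) \<Longrightarrow>
        \<eta> \<in> torus_lattice \<Longrightarrow> cmod (fourier_integral \<phi> \<eta>) * (1 + norm \<eta>) ^ (2 * DIM('a)) \<le> C * M"
      using fourier_integral_decay[of "2 * DIM('a)"] by metis
    define A where "A = B * C * suminf w"
    have A: "0 \<le> A" unfolding A_def using B C w by (simp add: suminf_nonneg)
    \<comment> \<open>The summand 1 keeps the denominator positive when
      \<open>A = 0\<close>.\<close>
    define M where "M = e / (A + 1)"
    have M: "0 < M" "A * M < e" using e A by (auto simp: M_def field_simps)
    have "\<forall>\<^sub>F k in sequentially. \<forall>bs\<in>D. \<forall>x\<in>UNIV. dist (iter_partial bs (\<phi> k) x) 0 < M"
      using D \<phi> M unfolding Cinf_null_seq_def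
      by (intro eventually_ball_finite ballI uniform_limitD) auto
    then obtain N where N: "\<And>k bs x. N \<le> k \<Longrightarrow> bs \<in> D \<Longrightarrow> cmod (iter_partial bs (\<phi> k) x) < M"
      unfolding eventually_sequentially by auto
    have "norm (u (\<phi> k) - 0) < e" if k: "N \<le> k" for k
    proof -
      have "cmod (u (\<phi> k)) \<le> (\<Sum>j. B * (C * M) * w j)"
        unfolding u_def using N[OF k] M
        by (intro norm_suminf_le bound * \<phi>C summable_mult w) (auto intro: less_imp_le)
      also have "\<dots> = A * M"
        by (simp add: suminf_mult w A_def)
      finally show ?thesis using M by simp
    qed
    then show "\<exists>N. \<forall>k\<ge>N. norm (u (\<phi> k) - 0) < e" by blast
  qed
  have FI_add: "fourier_integral (\<lambda>x. \<phi> x + \<psi> x) \<eta> = fourier_integral \<phi> \<eta> + fourier_integral \<psi> \<eta>"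
    if "\<phi> \<in> Cinf_torus" "\<psi> \<in> Cinf_torus" for \<phi> \<psi> :: "'a \<Rightarrow> complex" and \<eta>
    unfolding fourier_integral_def distrib_right
    by (intro integral_add integrable_continuous continuous_intros Cinf_continuous_on that)
  have FI_mult: "fourier_integral (\<lambda>x. a * \<phi> x) \<eta> = a * fourier_integral \<phi> \<eta>" for a \<phi> and \<eta> :: 'a
    unfolding fourier_integral_def by (simp add: mult.assoc)
  show "u \<in> distributions"
    unfolding distributions_def
  proof (intro CollectI conjI ballI allI impI)
    fix \<phi> \<psi> :: "'a \<Rightarrow> complex" assume "\<phi> \<in> Cinf_torus" "\<psi> \<in> Cinf_torus"
    then show "u (\<lambda>x. \<phi> x + \<psi> x) = u \<phi> + u \<psi>"
      unfolding u_def by (simp add: FI_add distrib_left suminf_add sm)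
  next
    fix a and \<phi> :: "'a \<Rightarrow> complex" assume "\<phi> \<in> Cinf_torus"
    then show "u (\<lambda>x. a * \<phi> x) = a * u \<phi>"
      unfolding u_def FI_mult mult.left_commute[of _ a] by (simp add: suminf_mult sm)
  qed (rule lim)
  fix \<eta> :: 'a assume \<eta>: "\<eta> \<in> torus_lattice"
  obtain j where j: "\<eta> = freq j"
    using \<eta> by (rule torus_lattice_freqE)
  define A :: complex where "A = of_real ((2 * pi) ^ DIM('a))"
  have "fourier_integral (\<lambda>x. cis (- (x \<bullet> \<eta>))) (- freq k) = (if k = j then A else 0)" for k
  proof -
    have "fourier_integral (\<lambda>x. cis (- (x \<bullet> \<eta>))) (- freq k)
        = integral torus_cube (\<lambda>x. cis (x \<bullet> (freq k - \<eta>)))"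
      unfolding fourier_integral_def by (simp add: cis_mult inner_diff_right)
    also have "\<dots> = (if freq k - \<eta> = 0 then A else 0)"
      unfolding A_def by (intro integral_character torus_lattice_diff \<eta> freq_in_lattice)
    finally show ?thesis by (simp add: j)
  qed
  then have "c (freq k) * fourier_integral (\<lambda>x. cis (- (x \<bullet> \<eta>))) (- freq k) = (if k
      = j then c (freq k) * A else 0)" for k
    by simp
  then have "u (\<lambda>x. cis (- (x \<bullet> \<eta>))) = (\<Sum>k. if k = j then c (freq k) * A else 0)"
    unfolding u_def by presburger
  also have "\<dots> = c \<eta> * A"
    using sums_single[of j "\<lambda>k. c (freq k) * A"] by (simp add: sums_iff j)
  finally show "fourier_coeff u \<eta> = c \<eta>"
    by (simp add: fourier_coeff_def A_def)
qed


section \<open>Matrices and symbols\<close>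

lemma poly_det: "poly (det M) x = det (map_matrix (\<lambda>p. poly p x) M)"
  by (simp add: det_def poly_sum poly_prod)

lemma det_uminus:
  fixes A :: "'a::comm_ring_1 ^ 'm ^ 'm"
  shows "det (- A) = (- 1) ^ CARD('m) * det A"
  by (simp add: det_def prod_uminus sum_distrib_left mult_ac)

text \<open>The characteristic polynomial is evaluated at \<open>- z\<close>; matrix and linear
  factors each change sign, and the two signs cancel.\<close>

lemma det_shift_eigenvalue_listing:
  fixes A :: "complex ^ 'm ^ 'm"
  assumes "eigenvalue_listing A k"
  shows "det (mat z + A) = (\<Prod>j\<in>UNIV. (z + k j))"
proof -
  have "map_matrix (\<lambda>p. poly p (- z)) (mat [:0, 1:] - map_matrix (\<lambda>a. [:a:]) A) = - (mat z + A)"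
    by (simp add: vec_eq_iff mat_def)
  then have "poly (charpoly A) (- z) = (- 1) ^ CARD('m) * det (mat z + A)"
    unfolding charpoly_def poly_det by (simp only: det_uminus)
  moreover have "poly (charpoly A) (- z) = (\<Prod>j\<in>UNIV. - (z + k j))"
    using assms by (simp add: eigenvalue_listing_def poly_prod algebra_simps)
  ultimately have "(- 1) ^ CARD('m) * det (mat z + A) = (- 1) ^ CARD('m) * (\<Prod>j\<in>UNIV. (z + k j))"
    by (simp only: prod_uminus)
  then show ?thesis by simp
qed

lemma mat_mult_vector: "mat c *v v = c *s (v :: 'a::comm_ring_1 ^ 'm)"
  by (simp add: vec_eq_iff matrix_vector_mult_def mat_def if_distrib if_distribR cong: if_cong)

text \<open>A normalised kernel vector of \<open>A - k j\<close>. It is independent of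
  \<open>z\<close>, so one choice serves every \<open>\<tau>\<close>.\<close>

lemma eigenvalue_listing_eigenvector:
  fixes A :: "complex ^ 'm ^ 'm"
  assumes "eigenvalue_listing A k"
  obtains v where "norm v = 1" "\<And>z. (mat z + A) *v v = (z + k j) *s v"
proof -
  have "det (mat (- k j) + A) = 0"
    unfolding det_shift_eigenvalue_listing[OF assms] by (rule prod_zero) auto
  then have "\<not> (\<forall>x. (mat (- k j) + A) *v x = 0 \<longrightarrow> x = 0)"
    unfolding matrix_left_invertible_ker[symmetric] invertible_left_inverse[symmetric]
        invertible_det_nz by simp
  then obtain x where x: "(mat (- k j) + A) *v x = 0" "x \<noteq> 0"
    by blast
  define v where "v = complex_of_real (1 / norm x) *s x"
  have "v = (1 / norm x) *\<^sub>R x"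
    by (auto simp: v_def vec_eq_iff) (simp add: scaleR_conv_of_real field_simps)
  then have "norm v = 1" using x by simp
  moreover have "(mat z + A) *v v = (z + k j) *s v" for z
  proof -
    have "mat z + A = mat (z + k j) + (mat (- k j) + A)"
      by (simp add: vec_eq_iff mat_def)
    then have eq: "(mat z + A) *v x = (z + k j) *s x"
      using x by (simp add: matrix_vector_mult_add_rdistrib mat_mult_vector)
    show ?thesis
      unfolding v_def vector_scalar_commute eq vector_smult_assoc by (simp only: mult.commute)
  qed
  ultimately show thesis by (rule that)
qed

text \<open>After the column replacement of Cramer's rule, every product in the Leibniz expansion
  has exactly one factor from the right-hand side, bounded by \<open>F\<close>, and otherwise
  entries bounded by \<open>a\<close>.\<close>

lemma cramer_bound:
  fixes A :: "complex ^ 'm ^ 'm"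
  assumes A: "\<And>i j. cmod (A $ i $ j) \<le> a" and a: "1 \<le> a" and b: "\<And>i. cmod ((A *v x) $ i) \<le> F"
  shows "cmod (x $ k) * cmod (det A) \<le> fact CARD('m) * (a ^ CARD('m) * F)"
proof -
  define B :: "complex ^ 'm ^ 'm" where "B = (\<chi> i j. if j = k then (A *v x) $ i else A $ i $ j)"
  have F: "0 \<le> F" using b norm_ge_zero order_trans by blast
  have prod_le: "cmod (of_int (sign p) * (\<Prod>i\<in>UNIV. B $ i $ p i)) \<le> a ^ CARD('m) * F"
      if p: "p permutes UNIV" for p
  proof -
    have "cmod (of_int (sign p) * (\<Prod>i\<in>UNIV. B $ i $ p i)) = (\<Prod>i\<in>UNIV. cmod (B $ i $ p i))"
      by (simp add: norm_mult prod_norm sign_def)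
    also have "\<dots> \<le> (\<Prod>i\<in>UNIV. if p i = k then F else a)"
      by (intro prod_mono) (auto simp: B_def A b)
    also have "\<dots> = (\<Prod>j\<in>UNIV. if j = k then F else a)"
      using prod.permute[OF p, of "\<lambda>j. if j = k then F else a"] by (simp add: o_def)
    also have "\<dots> = F * a ^ (CARD('m) - 1)"
      by (subst prod.remove[of _ k]) (auto simp: card_Diff_singleton)
    also have "\<dots> \<le> F * a ^ CARD('m)"
      using F a by (intro mult_left_mono power_increasing) auto
    finally show ?thesis by (simp add: mult.commute)
  qed
  have "cmod (x $ k) * cmod (det A) = cmod (det B)"
    unfolding B_def cramer_lemma by (simp add: norm_mult)
  also have "\<dots> \<le> (\<Sum>p | p permutes (UNIV :: 'm set). a ^ CARD('m) * F)"
    unfolding det_def by (intro sum_norm_le prod_le) simp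
  also have "\<dots> = fact CARD('m) * (a ^ CARD('m) * F)"
    by (simp add: card_permutations[OF refl])
  finally show ?thesis .
qed

section \<open>Polynomial growth of the symbol matrix\<close>

lemma int_vec_norm_ge_1:
  assumes "\<xi> \<noteq> 0"
  shows "1 \<le> norm (int_vec \<xi>)"
proof -
  obtain i where "\<xi> $ i \<noteq> 0" using assms by (auto simp: vec_eq_iff)
  then have "1 \<le> \<bar>int_vec \<xi> $ i\<bar>" by (simp add: int_vec_def)
  also have "\<dots> \<le> norm (int_vec \<xi>)" by (rule component_le_norm_cart)
  finally show ?thesis .
qed

text \<open>Nonzero integer vectors have norm at least 1, so \<open>\<nu>\<close> can be rounded up
  to a natural exponent, to 0 if it is negative. The value at \<open>\<xi> = 0\<close>, free in the
  symbol class, is added to the constant.\<close>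

lemma symbol_class_poly_bound:
  assumes "a \<in> symbol_class \<nu>"
  shows "\<exists>C\<ge>0. \<forall>\<xi>. cmod (a \<xi>) \<le> C * (1 + norm (int_vec \<xi>)) ^ nat \<lceil>\<nu>\<rceil>"
proof -
  obtain C where C: "0 < C" "\<And>\<xi>. \<xi> \<noteq> 0 \<Longrightarrow> cmod (a \<xi>) \<le> C * norm (int_vec \<xi>) powr \<nu>"
    using assms by (auto simp: symbol_class_def)
  have "cmod (a \<xi>) \<le> (C + cmod (a 0)) * (1 + norm (int_vec \<xi>)) ^ nat \<lceil>\<nu>\<rceil>" for \<xi>
  proof (cases "\<xi> = 0")
    case True
    then show ?thesis using C by (simp add: int_vec_def zero_vec_def[symmetric])
  next
    case False
    note 1 = int_vec_norm_ge_1[OF False]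
    have "norm (int_vec \<xi>) powr \<nu> \<le> norm (int_vec \<xi>) powr real (nat \<lceil>\<nu>\<rceil>)"
      using 1 by (intro powr_mono) linarith+
    also have "\<dots> = norm (int_vec \<xi>) ^ nat \<lceil>\<nu>\<rceil>"
      using 1 by (intro powr_realpow) linarith
    also have "\<dots> \<le> (1 + norm (int_vec \<xi>)) ^ nat \<lceil>\<nu>\<rceil>"
      by (intro power_mono) auto
    finally have "C * norm (int_vec \<xi>) powr \<nu> \<le> C * (1 + norm (int_vec \<xi>)) ^ nat \<lceil>\<nu>\<rceil>"
      using C by (intro mult_left_mono) auto
    also have "\<dots> \<le> (C + cmod (a 0)) * (1 + norm (int_vec \<xi>)) ^ nat \<lceil>\<nu>\<rceil>"
      by (intro mult_right_mono) auto
    finally show ?thesis using C(2)[OF False] by linarith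
  qed
  then show ?thesis using C by (intro exI[of _ "C + cmod (a 0)"]) auto
qed

lemma lattice_point_in_lattice: "(real_of_int \<tau>, int_vec \<xi>) \<in> torus_lattice"
  unfolding torus_lattice_def
  by (auto simp: Basis_prod_def Basis_vec_def inner_axis int_vec_def)

lemma torus_lattice_pointE:
  fixes \<eta> :: "real \<times> (real ^ 'n)"
  assumes "\<eta> \<in> torus_lattice"
  obtains \<tau> \<xi> where "\<eta> = (real_of_int \<tau>, int_vec \<xi>)"
proof
  have "\<eta> \<bullet> (1, 0) \<in> \<int>" "\<eta> \<bullet> (0, axis i 1) \<in> \<int>" for i
    by (intro Ints_inner_torus_lattice[OF assms]; auto simp: Basis_prod_def axis_in_Basis_iff)+
  then have "fst \<eta> \<in> \<int>" "snd \<eta> $ i \<in> \<int>" for i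
    by (cases \<eta>; simp add: inner_axis)+
  then show "\<eta> = (real_of_int \<lfloor>fst \<eta>\<rfloor>, int_vec (\<chi> i. \<lfloor>snd \<eta> $ i\<rfloor>))"
    by (simp add: prod_eq_iff vec_eq_iff int_vec_def)
qed

lemma symbol_matrix_poly_bound:
  fixes Q :: "int ^ 'n \<Rightarrow> complex ^ 'm ^ 'm"
  assumes "\<And>j k. (\<lambda>\<xi>. Q \<xi> $ j $ k) \<in> symbol_class \<nu>"
  obtains C K where "1 \<le> C" "\<And>\<tau> \<xi> j k. cmod ((mat (of_int \<tau>) + Q \<xi>) $ j $ k) \<le> C * (1
      + norm (real_of_int \<tau>, int_vec \<xi>)) ^ K"
proof -
  have "\<forall>j k. \<exists>C\<ge>0. \<forall>\<xi>. cmod (Q \<xi> $ j $ k) \<le> C * (1 + norm (int_vec \<xi>)) ^ nat \<lceil>\<nu>\<rceil>"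
    using symbol_class_poly_bound[OF assms] by blast
  then obtain C where C0: "\<And>j k. 0 \<le> C j k"
    and C: "\<And>j k \<xi>. cmod (Q \<xi> $ j $ k) \<le> C j k * (1 + norm (int_vec \<xi>)) ^ nat \<lceil>\<nu>\<rceil>"
    by metis
  \<comment> \<open>The successor makes room for the linear growth of \<open>\<tau>\<close> on the
    diagonal.\<close>
  define K where "K = Suc (nat \<lceil>\<nu>\<rceil>)"
  define C' where "C' = 1 + (\<Sum>j\<in>UNIV. \<Sum>k\<in>UNIV. C j k)"
  have "cmod ((mat (of_int \<tau>) + Q \<xi>) $ j $ k) \<le> C' * (1 + norm (real_of_int \<tau>, int_vec \<xi>)) ^ K"
      for \<tau> \<xi> j k
  proof -
    define N where "N = norm (real_of_int \<tau>, int_vec \<xi>)"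
    have N: "0 \<le> N" "\<bar>real_of_int \<tau>\<bar> \<le> N" "norm (int_vec \<xi>) \<le> N"
      unfolding N_def using norm_fst_le[of "real_of_int \<tau>" "int_vec \<xi>"] norm_snd_le[of "int_vec \<xi>"
          "real_of_int \<tau>"] by auto
    have "cmod ((mat (of_int \<tau>) + Q \<xi>) $ j $ k) \<le> cmod (mat (of_int \<tau>) $ j $ k)
        + cmod (Q \<xi> $ j $ k)"
      by (simp add: norm_triangle_ineq)
    also have "cmod (mat (of_int \<tau>) $ j $ k) \<le> (1 + N) ^ 1"
      using N by (simp add: mat_def)
    also have "\<dots> \<le> (1 + N) ^ K"
      using N by (intro power_increasing) (auto simp: K_def)
    also have "cmod (Q \<xi> $ j $ k) \<le> C j k * (1 + norm (int_vec \<xi>)) ^ nat \<lceil>\<nu>\<rceil>" by (rule C)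
    also have "\<dots> \<le> C j k * (1 + N) ^ nat \<lceil>\<nu>\<rceil>"
      using N C0 by (intro mult_left_mono power_mono) auto
    also have "\<dots> \<le> C j k * (1 + N) ^ K"
      unfolding K_def using N C0 by (intro mult_left_mono power_increasing le_SucI order_refl) auto
    also have "C j k \<le> (\<Sum>k\<in>UNIV. C j k)"
      using C0 by (intro member_le_sum) auto
    also have "\<dots> \<le> (\<Sum>j\<in>UNIV. \<Sum>k\<in>UNIV. C j k)"
      using C0 by (intro member_le_sum[of j _ "\<lambda>j. \<Sum>k\<in>UNIV. C j k"] sum_nonneg) auto
    finally show ?thesis
      using N by (simp add: C'_def N_def algebra_simps mult_right_mono)
  qed
  moreover have "1 \<le> C'" unfolding C'_def using C0 by (simp add: sum_nonneg)
  ultimately show thesis using that by blast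
qed

text \<open>The eigenvalue condition measures frequencies by the sum of the two sizes, rapid
  decrease by the Euclidean norm; this bound and the next make them interchangeable up to a factor
  2.\<close>

lemma norm_lattice_point_le: "norm (real_of_int \<tau>, int_vec \<xi>) \<le> real_of_int \<bar>\<tau>\<bar> + norm (int_vec \<xi>)"
  using norm_Pair_le[of "real_of_int \<tau>" "int_vec \<xi>"] by simp

lemma lattice_point_le_norm: "real_of_int \<bar>\<tau>\<bar> + norm (int_vec \<xi>) \<le> 2
    * norm (real_of_int \<tau>, int_vec \<xi>)"
  using norm_fst_le[of "real_of_int \<tau>" "int_vec \<xi>"] norm_snd_le[of "int_vec \<xi>" "real_of_int \<tau>"]
      by simp


section \<open>Global hypoellipticity\<close>

lemma rapidly_decreasing_cong:
  assumes "\<And>\<eta>. \<eta> \<in> torus_lattice \<Longrightarrow> c \<eta> = d \<eta>"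
  shows "rapidly_decreasing c \<longleftrightarrow> rapidly_decreasing d"
  using assms by (simp add: rapidly_decreasing_def)

text \<open>Cramer's rule mixes components, so one component of the solution is dominated by all
  components of the right-hand side.\<close>

lemma rapidly_decreasing_dominated_sum:
  fixes d :: "'j \<Rightarrow> 'a::euclidean_space \<Rightarrow> complex"
  assumes d: "\<And>j. j \<in> J \<Longrightarrow> rapidly_decreasing (d j)" and F: "finite F" and B: "0 \<le> B"
    and c: "\<And>\<eta>. \<eta> \<in> torus_lattice - F \<Longrightarrow> cmod (c \<eta>) \<le> B * (1 + norm \<eta>) ^ p * (\<Sum>j\<in>J. cmod (d j \<eta>))"
  shows "rapidly_decreasing c"
proof (rule rapidly_decreasing_cofiniteI)
  fix K
  have "\<forall>j\<in>J. \<exists>C. \<forall>\<eta>\<in>torus_lattice. cmod (d j \<eta>) * (1 + norm \<eta>) ^ (p + K) \<le> C"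
    using d unfolding rapidly_decreasing_def by blast
  then obtain C where C: "\<And>j \<eta>. j \<in> J \<Longrightarrow> \<eta> \<in> torus_lattice \<Longrightarrow> cmod (d j \<eta>) * (1 + norm \<eta>) ^ (p + K)
      \<le> C j"
    by metis
  have "cmod (c \<eta>) * (1 + norm \<eta>) ^ K \<le> B * (\<Sum>j\<in>J. C j)" if \<eta>: "\<eta> \<in> torus_lattice - F" for \<eta>
  proof -
    have "cmod (c \<eta>) * (1 + norm \<eta>) ^ K \<le> B * (1 + norm \<eta>) ^ p * (\<Sum>j\<in>J. cmod (d j \<eta>)) * (1
        + norm \<eta>) ^ K"
      by (intro mult_right_mono c[OF \<eta>]) auto
    also have "\<dots> = B * (\<Sum>j\<in>J. cmod (d j \<eta>) * (1 + norm \<eta>) ^ (p + K))"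
      by (simp add: power_add sum_distrib_left sum_distrib_right mult_ac)
    also have "\<dots> \<le> B * (\<Sum>j\<in>J. C j)"
      using \<eta> B by (intro mult_left_mono sum_mono C) auto
    finally show ?thesis .
  qed
  then show "\<exists>C F. finite F \<and> (\<forall>\<eta>\<in>torus_lattice - F. cmod (c \<eta>) * (1 + norm \<eta>) ^ K \<le> C)"
    using F by blast
qed

text \<open>Common constants and a natural exponent allow the factors to be multiplied over
  \<open>j\<close>; the product form avoids negative powers.\<close>

lemma eigenvalue_lower_bound_uniform:
  fixes \<kappa> :: "'m::finite \<Rightarrow> int ^ 'n \<Rightarrow> complex" and C M R :: "'m \<Rightarrow> real"
  assumes pos: "\<And>j. C j > 0" "\<And>j. M j > 0" "\<And>j. R j > 0"
    and lower: "\<And>j \<tau> \<xi>. real_of_int \<bar>\<tau>\<bar> + norm (int_vec \<xi>) \<ge> R j \<Longrightarrow>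
      cmod (of_int \<tau> + \<kappa> j \<xi>) \<ge> C j * (real_of_int \<bar>\<tau>\<bar> + norm (int_vec \<xi>)) powr (- M j)"
  obtains c :: real and L :: nat and r :: real where "0 < c" "\<And>j \<tau> \<xi>. r
      \<le> norm (real_of_int \<tau>, int_vec \<xi>) \<Longrightarrow>
    c \<le> cmod (of_int \<tau> + \<kappa> j \<xi>) * (1 + norm (real_of_int \<tau>, int_vec \<xi>)) ^ L"
proof
  define L where "L = nat \<lceil>\<Sum>j\<in>UNIV. M j\<rceil>"
  define r where "r = (\<Sum>j\<in>UNIV. R j)"
  define c where "c = Min (range C) / 2 ^ L"
  show "0 < c" using pos by (simp add: c_def)
  fix j \<tau> and \<xi> :: "int ^ 'n" assume r: "r \<le> norm (real_of_int \<tau>, int_vec \<xi>)"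
  define N where "N = norm (real_of_int \<tau>, int_vec \<xi>)"
  define s where "s = real_of_int \<bar>\<tau>\<bar> + norm (int_vec \<xi>)"
  have N: "0 \<le> N" by (simp add: N_def)
  have "R j \<le> r" unfolding r_def using pos by (intro member_le_sum) (auto intro: less_imp_le)
  moreover have "s \<le> 2 * (1 + N)"
    using lattice_point_le_norm[of \<tau> \<xi>] unfolding N_def s_def by simp
  ultimately have s: "R j \<le> s" "s \<le> 2 * (1 + N)"
    using r norm_lattice_point_le[of \<tau> \<xi>] unfolding s_def by simp_all
  have s0: "0 < s" using s pos(3)[of j] by linarith
  have "M j \<le> (\<Sum>j\<in>UNIV. M j)" using pos by (intro member_le_sum) (auto intro: less_imp_le)
  then have M_le: "M j \<le> real L" unfolding L_def by linarith
  have "c * 2 ^ L \<le> C j" by (simp add: c_def)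
  \<comment> \<open>Inserting a factor equal to 1 separates two changes: the exponent
    \<open>M j\<close> is raised to \<open>L\<close> with base at least 1, then the base
    \<open>2 * (1 + N)\<close> is lowered to \<open>s\<close>. The factor \<open>2 ^ L\<close> in
    the definition of \<open>c\<close> compensates.\<close>
  also have "C j = C j * ((2 * (1 + N)) powr (- real L) * (2 * (1 + N)) ^ L)"
    using N by (simp add: powr_minus powr_realpow)
  also have "\<dots> \<le> C j * ((2 * (1 + N)) powr (- M j) * (2 * (1 + N)) ^ L)"
    using N M_le pos(1)[of j] by (intro mult_left_mono mult_right_mono powr_mono) auto
  also have "\<dots> \<le> C j * (s powr (- M j) * (2 * (1 + N)) ^ L)"
    using N s s0 pos(1)[of j] pos(2)[of j] by (intro mult_left_mono mult_right_mono powr_mono2')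
        auto
  also have "\<dots> = C j * s powr (- M j) * (2 * (1 + N)) ^ L"
    by simp
  also have "\<dots> \<le> cmod (of_int \<tau> + \<kappa> j \<xi>) * (2 * (1 + N)) ^ L"
    using lower[of j \<tau> \<xi>] s N unfolding s_def by (intro mult_right_mono) auto
  also have "\<dots> = cmod (of_int \<tau> + \<kappa> j \<xi>) * (1 + N) ^ L * 2 ^ L"
    unfolding power_mult_distrib by simp
  finally show "c \<le> cmod (of_int \<tau> + \<kappa> j \<xi>) * (1 + norm (real_of_int \<tau>, int_vec \<xi>)) ^ L"
    by (simp add: N_def)
qed

lemma globally_hypoelliptic_if_lower_bound:
  fixes Q :: "int ^ 'n \<Rightarrow> complex ^ 'm ^ 'm" and \<kappa> :: "'m \<Rightarrow> int ^ 'n \<Rightarrow> complex"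
  assumes symbol: "\<And>j k. (\<lambda>\<xi>. Q \<xi> $ j $ k) \<in> symbol_class \<nu>"
    and eigen: "\<And>\<xi>. eigenvalue_listing (Q \<xi>) (\<lambda>j. \<kappa> j \<xi>)"
    and c: "0 < c" and lower: "\<And>j \<tau> \<xi>. r \<le> norm (real_of_int \<tau>, int_vec \<xi>) \<Longrightarrow>
      c \<le> cmod (of_int \<tau> + \<kappa> j \<xi>) * (1 + norm (real_of_int \<tau>, int_vec \<xi>)) ^ L"
  shows "globally_hypoelliptic Q"
  unfolding globally_hypoelliptic_def
proof (intro ballI impI)
  fix u f :: "((real \<times> (real ^ 'n) \<Rightarrow> complex) \<Rightarrow> complex) ^ 'm"
  assume u: "u \<in> distributions_vec" and f: "f \<in> smooth_distributions_vec" and eq: "system_eq Q u f"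
  have u': "u $ i \<in> distributions" for i using u by (simp add: distributions_vec_def)
  have f': "rapidly_decreasing (fourier_coeff (f $ i))" for i
  proof -
    have "f $ i \<in> smooth_distributions" using f by (simp add: smooth_distributions_vec_def)
    moreover then have "f $ i \<in> distributions" by (simp add: smooth_distributions_def)
    ultimately show ?thesis using smooth_distributions_iff by blast
  qed
  obtain a K where a: "1 \<le> a" and entry: "\<And>\<tau> \<xi> j k. cmod ((mat (of_int \<tau>) + Q \<xi>) $ j $ k) \<le> a * (1
      + norm (real_of_int \<tau>, int_vec \<xi>)) ^ K"
    using symbol_matrix_poly_bound[OF symbol] by blast
  define m where "m = CARD('m)"
  have "rapidly_decreasing (fourier_coeff (u $ i))" for i
  \<comment> \<open>Cramer's rule costs \<open>K * m\<close> powers through the entries, and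
    dividing by the determinant costs \<open>L * m\<close> more. Frequencies of norm at most
    \<open>r\<close> form the finite exceptional set.\<close>
  proof (rule rapidly_decreasing_dominated_sum[where d = "\<lambda>j. fourier_coeff (f $ j)" and J = UNIV
        and F = "{\<eta> \<in> torus_lattice. norm \<eta> \<le> r}" and B = "fact m * a ^ m / c ^ m" and p = "(K
            + L) * m"])
    show "0 \<le> fact m * a ^ m / c ^ m" using a c by simp
    fix \<eta> :: "real \<times> (real ^ 'n)"
    assume \<eta>: "\<eta> \<in> torus_lattice - {\<eta> \<in> torus_lattice. norm \<eta> \<le> r}"
    then obtain \<tau> \<xi> where \<tau>\<xi>: "\<eta> = (real_of_int \<tau>, int_vec \<xi>)"
      using torus_lattice_pointE by blast
    define A where "A = mat (of_int \<tau>) + Q \<xi>"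
    define x where "x = fourier_coeff_vec u \<eta>"
    define S where "S = (\<Sum>j\<in>UNIV. cmod (fourier_coeff (f $ j) \<eta>))"
    define N where "N = 1 + norm \<eta>"
    have N: "1 \<le> N" by (simp add: N_def)
    have Ax: "A *v x = fourier_coeff_vec f \<eta>"
      using eq unfolding system_eq_def A_def x_def \<tau>\<xi> by blast
    have "cmod (x $ i) * cmod (det A) \<le> fact CARD('m) * ((a * N ^ K) ^ CARD('m) * S)"
    proof (rule cramer_bound)
      show "cmod (A $ i $ j) \<le> a * N ^ K" for i j
        using entry[of \<tau> \<xi> i j] by (simp add: A_def N_def \<tau>\<xi>)
      show "1 \<le> a * N ^ K" using a N by (metis mult_mono' mult_1 one_le_power zero_le_one)
      show "cmod ((A *v x) $ j) \<le> S" for j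
        unfolding Ax S_def fourier_coeff_vec_def
        by (simp, intro member_le_sum[of j UNIV "\<lambda>j. cmod (fourier_coeff (f $ j) \<eta>)"]) auto
    qed
    then have up: "cmod (x $ i) * cmod (det A) \<le> fact m * (a ^ m * N ^ (K * m) * S)"
      by (simp add: m_def power_mult_distrib power_mult)
    have "(\<Prod>j\<in>(UNIV :: 'm set). c) \<le> (\<Prod>j\<in>UNIV. cmod (of_int \<tau> + \<kappa> j \<xi>) * N ^ L)"
      using lower[of \<tau> \<xi>] \<eta> c by (intro prod_mono) (auto simp: N_def \<tau>\<xi>)
    then have "c ^ m \<le> cmod (det A) * N ^ (L * m)"
      unfolding A_def det_shift_eigenvalue_listing[OF eigen]
      by (simp add: m_def prod.distrib prod_norm power_mult)
    then have "cmod (x $ i) * c ^ m \<le> cmod (x $ i) * (cmod (det A) * N ^ (L * m))"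
      by (intro mult_left_mono) auto
    also have "\<dots> \<le> fact m * (a ^ m * N ^ (K * m) * S) * N ^ (L * m)"
      using mult_right_mono[OF up, of "N ^ (L * m)"] N by (simp add: mult.assoc)
    also have "\<dots> = fact m * a ^ m * N ^ ((K + L) * m) * S"
      by (simp add: power_add algebra_simps)
    finally have "cmod (x $ i) \<le> fact m * a ^ m * N ^ ((K + L) * m) * S / c ^ m"
      using c by (simp add: pos_le_divide_eq)
    then show "cmod (fourier_coeff (u $ i) \<eta>) \<le> fact m * a ^ m / c ^ m * (1 + norm \<eta>) ^ ((K + L)
        * m) * (\<Sum>j\<in>UNIV. cmod (fourier_coeff (f $ j) \<eta>))"
      by (simp add: x_def fourier_coeff_vec_def N_def S_def)
  qed (simp_all add: f' finite_torus_lattice_bounded)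
  then show "u \<in> smooth_distributions_vec"
    using smooth_distributions_iff[OF u'] by (simp add: smooth_distributions_vec_def)
qed

text \<open>Unit eigenvectors at the given frequencies are bounded but do not decay, while the
  system multiplies each by a factor smaller than any fixed power of its frequency.\<close>

lemma not_globally_hypoelliptic_if_small:
  fixes Q :: "int ^ 'n \<Rightarrow> complex ^ 'm ^ 'm" and \<kappa> :: "'m \<Rightarrow> int ^ 'n \<Rightarrow> complex"
    and j :: 'm and p :: "nat \<Rightarrow> int \<times> (int ^ 'n)"
  assumes eigen: "\<And>\<xi>. eigenvalue_listing (Q \<xi>) (\<lambda>j. \<kappa> j \<xi>)"
  defines "s \<equiv> \<lambda>k. real_of_int \<bar>fst (p k)\<bar> + norm (int_vec (snd (p k)))"
  assumes large: "\<And>k. real (Suc k) \<le> s k"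
    and small: "\<And>k. cmod (of_int (fst (p k)) + \<kappa> j (snd (p k))) < s k powr (- real (Suc k))"
  shows "\<not> globally_hypoelliptic Q"
proof
  assume GH: "globally_hypoelliptic Q"
  define pt :: "int \<times> (int ^ 'n) \<Rightarrow> real \<times> (real ^ 'n)" where "pt
      = (\<lambda>(\<tau>, \<xi>). (real_of_int \<tau>, int_vec \<xi>))"
  \<comment> \<open>A left inverse of \<open>pt\<close>, total so that coefficients can be defined
    at real frequencies.\<close>
  define unpt :: "real \<times> (real ^ 'n) \<Rightarrow> int \<times> (int ^ 'n)" where "unpt
      = (\<lambda>\<eta>. (\<lfloor>fst \<eta>\<rfloor>, \<chi> i. \<lfloor>snd \<eta> $ i\<rfloor>))"
  have unpt: "unpt (pt q) = q" for q
    by (cases q) (simp add: pt_def unpt_def int_vec_def vec_eq_iff)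
  have "\<exists>v. norm v = 1 \<and> (\<forall>z. (mat z + Q \<xi>) *v v = (z + \<kappa> j \<xi>) *s v)" for \<xi>
    by (rule eigenvalue_listing_eigenvector[OF eigen, of \<xi> j]) blast
  then obtain v where v1: "\<And>\<xi>. norm (v \<xi> :: complex ^ 'm) = 1"
    and v: "\<And>\<xi> z. (mat z + Q \<xi>) *v v \<xi> = (z + \<kappa> j \<xi>) *s v \<xi>"
    by metis
  \<comment> \<open>Membership in the range, instead of an index \<open>k\<close>, makes this well
    defined even if the sequence repeats a point.\<close>
  define c where "c = (\<lambda>\<eta>. if \<eta> \<in> range (\<lambda>k. pt (p k)) then v (snd (unpt \<eta>)) else 0)"
  define \<mu> where "\<mu> = (\<lambda>\<eta>. of_int (fst (unpt \<eta>)) + \<kappa> j (snd (unpt \<eta>)))"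
  define d where "d = (\<lambda>i \<eta>. \<mu> \<eta> * c \<eta> $ i)"
  have c1: "cmod (c \<eta> $ i) \<le> 1" for \<eta> i
    using Finite_Cartesian_Product.norm_nth_le[of "v (snd (unpt \<eta>))" i] by (auto simp: c_def v1)
  have "rapidly_decreasing (d i)" for i
  proof (rule rapidly_decreasing_cofiniteI)
    fix K
    \<comment> \<open>For order \<open>K\<close> the first \<open>K\<close> points are discarded;
      all later ones have an exponent exceeding \<open>K\<close>.\<close>
    have "cmod (d i \<eta>) * (1 + norm \<eta>) ^ K \<le> 2 ^ K"
        if \<eta>: "\<eta> \<in> torus_lattice - (\<lambda>k. pt (p k)) ` {..<K}" for \<eta>
    proof (cases "\<eta> \<in> range (\<lambda>k. pt (p k))")
      case False
      then show ?thesis by (simp add: d_def c_def)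
    next
      case True
      then obtain k where k: "\<eta> = pt (p k)" "K \<le> k"
        using \<eta> by (auto simp: not_less[symmetric])
      have s1: "1 \<le> s k" using large[of k] by simp
      have "cmod (\<mu> \<eta>) \<le> s k powr (- real (Suc k))"
        using small[of k] by (simp add: \<mu>_def k unpt less_imp_le)
      also have "\<dots> \<le> s k powr (- real K)"
        using s1 k by (intro powr_mono) auto
      finally have \<mu>: "cmod (\<mu> \<eta>) * s k ^ K \<le> 1"
        using s1 by (simp add: powr_minus powr_realpow field_simps)
      have "norm \<eta> \<le> s k"
        using norm_lattice_point_le[of "fst (p k)" "snd (p k)"]
            by (simp add: k pt_def s_def case_prod_unfold)
      then have "(1 + norm \<eta>) ^ K \<le> (2 * s k) ^ K"
        using s1 by (intro power_mono) auto
      moreover have "cmod (d i \<eta>) \<le> cmod (\<mu> \<eta>)"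
        unfolding d_def norm_mult using c1 by (simp add: mult_left_le)
      ultimately have "cmod (d i \<eta>) * (1 + norm \<eta>) ^ K \<le> cmod (\<mu> \<eta>) * (2 * s k) ^ K"
        by (intro mult_mono) auto
      also have "\<dots> = 2 ^ K * (cmod (\<mu> \<eta>) * s k ^ K)"
        by (simp add: power_mult_distrib)
      also have "\<dots> \<le> 2 ^ K * 1"
        using \<mu> by (intro mult_left_mono) auto
      finally show ?thesis by simp
    qed
    then show "\<exists>C F. finite F \<and> (\<forall>\<eta>\<in>torus_lattice - F. cmod (d i \<eta>) * (1 + norm \<eta>) ^ K \<le> C)"
      by (intro exI[of _ "2 ^ K"] exI[of _ "(\<lambda>k. pt (p k)) ` {..<K}"]) auto
  qed
  note d = this
  have "\<exists>u. u \<in> distributions \<and> (\<forall>\<eta>\<in>torus_lattice. fourier_coeff u \<eta> = c \<eta> $ i)" for i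
    by (rule distribution_with_bounded_coeffs[where c = "\<lambda>\<eta>. c \<eta> $ i" and B = 1]) (use c1 in blast)+
  then obtain U where U: "\<And>i. U i \<in> distributions" "\<And>i \<eta>. \<eta> \<in> torus_lattice \<Longrightarrow>
      fourier_coeff (U i) \<eta> = c \<eta> $ i"
    by metis
  have "\<exists>u. u \<in> distributions \<and> (\<forall>\<eta>\<in>torus_lattice. fourier_coeff u \<eta> = d i \<eta>)" for i
  proof -
    \<comment> \<open>Order 0 of rapid decrease is boundedness, enough to realise \<open>d i\<close>
      as coefficients of a distribution.\<close>
    obtain B where "\<And>\<eta>. \<eta> \<in> torus_lattice \<Longrightarrow> cmod (d i \<eta>) * (1 + norm \<eta>) ^ 0 \<le> B"
      using d[of i] unfolding rapidly_decreasing_def by metis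
    then have bd: "cmod (d i \<eta>) \<le> B" if "\<eta> \<in> torus_lattice" for \<eta>
      using that by simp
    show ?thesis
      by (rule distribution_with_bounded_coeffs[where c = "d i" and B = B]) (use bd in blast)+
  qed
  then obtain V where V: "\<And>i. V i \<in> distributions" "\<And>i \<eta>. \<eta> \<in> torus_lattice \<Longrightarrow>
      fourier_coeff (V i) \<eta> = d i \<eta>"
    by metis
  define u f where "u = (\<chi> i. U i)" and "f = (\<chi> i. V i)"
  have "V i \<in> smooth_distributions" for i
    using d[of i] smooth_distributions_iff[OF V(1)] rapidly_decreasing_cong[of "fourier_coeff (V
        i)" "d i"] V(2) by blast
  then have "f \<in> smooth_distributions_vec"
    by (simp add: f_def smooth_distributions_vec_def)
  moreover have "u \<in> distributions_vec"
    by (simp add: u_def distributions_vec_def U)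
  moreover have "system_eq Q u f"
    unfolding system_eq_def
  proof (intro allI)
    fix \<tau> :: int and \<xi> :: "int ^ 'n"
    define \<eta> where "\<eta> = (real_of_int \<tau>, int_vec \<xi>)"
    have \<eta>: "\<eta> \<in> torus_lattice" unfolding \<eta>_def by (rule lattice_point_in_lattice)
    have "unpt \<eta> = (\<tau>, \<xi>)" using unpt[of "(\<tau>, \<xi>)"] by (simp add: \<eta>_def pt_def)
    then have "(mat (of_int \<tau>) + Q \<xi>) *v c \<eta> = \<mu> \<eta> *s c \<eta>"
      by (simp add: c_def \<mu>_def v)
    moreover have "fourier_coeff_vec u \<eta> = c \<eta>" "fourier_coeff_vec f \<eta> = \<mu> \<eta> *s c \<eta>"
      by (simp_all add: fourier_coeff_vec_def vec_eq_iff u_def f_def U V \<eta> d_def)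
    ultimately show "(mat (of_int \<tau>) + Q \<xi>) *v fourier_coeff_vec u (real_of_int \<tau>, int_vec \<xi>)
       = fourier_coeff_vec f (real_of_int \<tau>, int_vec \<xi>)"
      by (simp add: \<eta>_def)
  qed
  ultimately have "u \<in> smooth_distributions_vec"
    using GH unfolding globally_hypoelliptic_def by blast
  then have "rapidly_decreasing (fourier_coeff (U i))" for i
    using smooth_distributions_iff[OF U(1)] by (simp add: u_def smooth_distributions_vec_def)
  \<comment> \<open>Decay of order 1 already contradicts coefficient vectors of norm 1 at unbounded
    frequencies.\<close>
  then have "\<exists>B. \<forall>\<eta>\<in>torus_lattice. cmod (fourier_coeff (U i) \<eta>) * (1 + norm \<eta>) ^ 1 \<le> B" for i
    unfolding rapidly_decreasing_def by blast
  then obtain B where B: "\<And>i \<eta>. \<eta> \<in> torus_lattice \<Longrightarrow> cmod (c \<eta> $ i) * (1 + norm \<eta>) \<le> B i"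
    using U(2) by (metis power_one_right)
  have le: "real (Suc k) \<le> 2 * (\<Sum>i\<in>UNIV. B i)" for k
  proof -
    define \<eta> where "\<eta> = pt (p k)"
    have \<eta>: "\<eta> \<in> torus_lattice"
      unfolding \<eta>_def pt_def case_prod_unfold by (rule lattice_point_in_lattice)
    have "c \<eta> = v (snd (unpt \<eta>))"
      unfolding c_def \<eta>_def by auto
    then have "1 = norm (c \<eta>)" by (simp add: v1)
    also have "\<dots> \<le> (\<Sum>i\<in>UNIV. cmod (c \<eta> $ i))"
      unfolding norm_vec_def by (rule L2_set_le_sum) simp
    finally have "1 * (1 + norm \<eta>) \<le> (\<Sum>i\<in>UNIV. cmod (c \<eta> $ i)) * (1 + norm \<eta>)"
      by (intro mult_right_mono) auto
    also have "\<dots> \<le> (\<Sum>i\<in>UNIV. B i)"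
      unfolding sum_distrib_right by (intro sum_mono B \<eta>)
    finally have "1 + norm \<eta> \<le> (\<Sum>i\<in>UNIV. B i)" by simp
    moreover have "s k \<le> 2 * norm \<eta>"
      using lattice_point_le_norm[of "fst (p k)" "snd (p k)"]
          by (simp add: \<eta>_def pt_def s_def case_prod_unfold)
    ultimately show ?thesis using large[of k] by linarith
  qed
  obtain k :: nat where "2 * (\<Sum>i\<in>UNIV. B i) < real k"
    using reals_Archimedean2 by blast
  with le[of k] show False by simp
qed

theorem theorem2p3:
  fixes Q :: "int ^ 'n \<Rightarrow> complex ^ 'm ^ 'm"
    and \<nu> :: real
    and \<kappa> :: "'m \<Rightarrow> int ^ 'n \<Rightarrow> complex"
  assumes "\<And>j k. (\<lambda>\<xi>. Q \<xi> $ j $ k) \<in> symbol_class \<nu>"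
    and "\<And>\<xi>. eigenvalue_listing (Q \<xi>) (\<lambda>j. \<kappa> j \<xi>)"
  shows "globally_hypoelliptic Q \<longleftrightarrow>
    (\<exists>(C :: 'm \<Rightarrow> real) (M :: 'm \<Rightarrow> real) (R :: 'm \<Rightarrow> real).
       \<forall>j. C j > 0 \<and> M j > 0 \<and> R j > 0 \<and>
         (\<forall>(\<tau>::int) \<xi>. real_of_int \<bar>\<tau>\<bar> + norm (int_vec \<xi>) \<ge> R j \<longrightarrow>
            cmod (of_int \<tau> + \<kappa> j \<xi>)
              \<ge> C j * (real_of_int \<bar>\<tau>\<bar> + norm (int_vec \<xi>)) powr (- M j)))"
    (is "_ \<longleftrightarrow> (\<exists>C M R. \<forall>j. ?P j (C j) (M j) (R j))")
proof
  assume GH: "globally_hypoelliptic Q"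
  have "\<exists>C M R. ?P j C M R" for j
  proof (rule ccontr)
    assume neg: "\<not> (\<exists>C M R. ?P j C M R)"
    have "\<exists>q. real (Suc k) \<le> real_of_int \<bar>fst q\<bar> + norm (int_vec (snd q)) \<and>
      cmod (of_int (fst q) + \<kappa> j (snd q)) < (real_of_int \<bar>fst q\<bar> + norm (int_vec (snd q))) powr (- real (Suc k))" for k
    proof -
      \<comment> \<open>Failure for all constants is sampled at \<open>C = 1\<close> and
        \<open>M = R = k + 1\<close>: one sequence then defeats every power and goes to
        infinity.\<close>
      have "\<not> ?P j 1 (real (Suc k)) (real (Suc k))" using neg by blast
      then obtain \<tau> \<xi> where "real (Suc k) \<le> real_of_int \<bar>\<tau>\<bar> + norm (int_vec \<xi>)"
        "\<not> cmod (of_int \<tau> + \<kappa> j \<xi>) \<ge> 1 * (real_of_int \<bar>\<tau>\<bar> + norm (int_vec \<xi>)) powr (- real (Suc k))"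
        by fastforce
      then show ?thesis by (intro exI[of _ "(\<tau>, \<xi>)"]) simp
    qed
    then obtain p where "\<And>k. real (Suc k) \<le> real_of_int \<bar>fst (p k)\<bar> + norm (int_vec (snd (p k)))"
      "\<And>k. cmod (of_int (fst (p k)) + \<kappa> j (snd (p k))) < (real_of_int \<bar>fst (p k)\<bar> + norm (int_vec (snd (p k)))) powr (- real (Suc k))"
      by metis
    from not_globally_hypoelliptic_if_small[OF assms(2) this] GH show False by blast
  qed
  then show "\<exists>C M R. \<forall>j. ?P j (C j) (M j) (R j)" by metis
next
  assume "\<exists>C M R. \<forall>j. ?P j (C j) (M j) (R j)"
  then obtain C M R where P: "\<And>j. ?P j (C j) (M j) (R j)" by metis
  obtain c L r where "0 < c" "\<And>j \<tau> \<xi>. r \<le> norm (real_of_int \<tau>, int_vec \<xi>) \<Longrightarrow>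
      c \<le> cmod (of_int \<tau> + \<kappa> j \<xi>) * (1 + norm (real_of_int \<tau>, int_vec \<xi>)) ^ L"
    by (rule eigenvalue_lower_bound_uniform[of C M R \<kappa>]) (use P in blast)+
  from globally_hypoelliptic_if_lower_bound[OF assms this] show "globally_hypoelliptic Q" .
qed

end
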